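(* Let $p$ be a prime, let $0<\varepsilon\leq \frac34$ be a real number, and let $\alpha$ be the unique positive root of the cubic $4x^3+(12-4\varepsilon)x^2+(9-4\varepsilon)x+(8\varepsilon-7)$. Let $A\subseteq\mathbb{Z}/p\mathbb{Z}$ be a nonempty subset and write $|2A|=2|A|+r$. Suppose that $$|2A|\leq (2+\alpha)|A|-3\qquad\text{and}\qquad |2A|\leq \varepsilon p.$$ Then there exist arithmetic progressions $P_A,P_{2A}\subseteq \mathbb{Z}/p\mathbb{Z}$ with the same common difference such that $A\subseteq P_A$, $|P_A|\leq |A|+r+1$, $P_{2A}\subseteq 2A$, and $|P_{2A}|\geq 2|A|-1$.
   Context: For $A\subseteq \mathbb{Z}/p\mathbb{Z}$, $2A=A+A=\{x+y: x,y\in A\}$. An arithmetic progression in $\mathbb{Z}/p\mathbb{Z}$ with difference $g\neq 0$ is a set of the form $\{a, a+g, a+2g,\dots,a+(k-1)g\}$ with $1\le k\le p$. *)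

theory Defs
  imports Complex_Main "HOL-Computational_Algebra.Primes"
begin

text \<open>Z/pZ is modelled by the residues {0..<p} :: nat set, with addition mod p.\<close>

definition sumset_mod :: "nat \<Rightarrow> nat set \<Rightarrow> nat set" where
  "sumset_mod p A = {(x + y) mod p | x y. x \<in> A \<and> y \<in> A}"

definition ap_mod :: "nat \<Rightarrow> nat \<Rightarrow> nat \<Rightarrow> nat \<Rightarrow> nat set" where
  "ap_mod p a g k = {(a + i * g) mod p | i. i < k}"

definition is_ap_diff :: "nat \<Rightarrow> nat \<Rightarrow> nat set \<Rightarrow> bool" where
  "is_ap_diff p g P \<longleftrightarrow> g mod p \<noteq> 0 \<and>
     (\<exists>a k. a < p \<and> 1 \<le> k \<and> k \<le> p \<and> P = ap_mod p a g k)"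

end

(*
If every nontrivial Fourier coefficient of A were at most (1 + 2 alpha)|A|/3, Parseval and
Cauchy-Schwarz would contradict the hypotheses; this threshold is where the cubic comes from. A large
coefficient forces some half-circle of residues, after a dilation, to contain a subset A' of A
with 3|A'| >= |2A| + 4. There A' behaves like a set of integers, and Freiman's 3k-4 theorem puts it
into a short progression, with a long progression inside 2A'. The complement C of 2A then lies in an
interval so short that C - A' is also a sumset of integers; it contains a long interval, which A
avoids. Hence A itself lies in a half-circle, and the 3k-4 theorem applies to A.

For sets of integers the tool is the walk x |-> |A \<inter> [0,x]| + |B \<inter> [0,x]| - (x + 1): by the
pigeonhole principle c + x is in A + B as soon as the walk is higher at x than at c - 1.
*)

theory Submission
  imports Defs "HOL-Library.Set_Algebras" "HOL-Analysis.Convex"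
begin

section \<open>The excess walk and sumsets of dense sets of integers\<close>

text \<open>The bound \<epsilon> <= 3/4 comes from the last step of the rectification. The interval
  avoided by A leaves room for |2A| - |A'| + 1 residues, and 3|A'| >= |2A| + 4 makes this fit into a
  half-circle once 4|2A| <= 3p.

  The delicate half of Freiman's theorem is density: k integers from 0 to l that contain both ends,
  have gcd 1 and have a sumset of size at most 3k - 4 satisfy l <= 2k - 4. No theorem on sums modulo
  l is used. In a smallest counterexample each end consists of two consecutive integers, so the two
  sides of a cut keep gcd 1 and minimality applies to them. At suitable cuts one side must have
  small doubling, hence be dense, and its walk controls that of the whole set.\<close>

definition excess :: "int set \<Rightarrow> int set \<Rightarrow> int \<Rightarrow> int" where
  "excess A B x = int (card (A \<inter> {0..x})) + int (card (B \<inter> {0..x})) - (x + 1)"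

lemma card_window:
  fixes A :: "int set"
  assumes "0 \<le> c" "c - 1 \<le> x"
  shows "int (card (A \<inter> {c..x})) = int (card (A \<inter> {0..x})) - int (card (A \<inter> {0..c - 1}))"
proof -
  have "A \<inter> {0..x} = (A \<inter> {0..c - 1}) \<union> (A \<inter> {c..x})"
    using assms by auto
  moreover have "(A \<inter> {0..c - 1}) \<inter> (A \<inter> {c..x}) = {}"
    by auto
  ultimately have "card (A \<inter> {0..x}) = card (A \<inter> {0..c - 1}) + card (A \<inter> {c..x})"
    by (metis card_Un_disjoint finite_Int finite_atLeastAtMost_int)
  then show ?thesis by simp
qed

lemma mem_sumset_pigeonhole:
  fixes A B :: "int set"
  assumes "u \<le> v + 1" "int (card (A \<inter> {u..v})) + int (card (B \<inter> {u..v})) > v - u + 1"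
  shows "u + v \<in> A + B"
proof -
  let ?X = "A \<inter> {u..v}" and ?Y = "(\<lambda>b. u + v - b) ` (B \<inter> {u..v})"
  have cY: "card ?Y = card (B \<inter> {u..v})"
    by (intro card_image) (auto simp: inj_on_def)
  have "?X \<inter> ?Y \<noteq> {}"
  proof
    assume "?X \<inter> ?Y = {}"
    then have "card (?X \<union> ?Y) = card ?X + card ?Y"
      by (intro card_Un_disjoint) auto
    moreover have "card (?X \<union> ?Y) \<le> card {u..v}"
      by (intro card_mono) auto
    ultimately show False using assms cY by simp
  qed
  then obtain b where "b \<in> B" "u + v - b \<in> A" by auto
  then have "(u + v - b) + b \<in> A + B" by (intro set_plus_intro)
  then show ?thesis by simp
qed

lemma excess_window:
  assumes "0 \<le> c" "c - 1 \<le> x" "excess A B (c - 1) < excess A B x"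
  shows "c + x \<in> A + B"
  using assms card_window[of c x A] card_window[of c x B]
  by (intro mem_sumset_pigeonhole) (auto simp: excess_def)

lemma excess_minus_one [simp]: "excess A B (-1) = 0"
  by (simp add: excess_def)

lemma excess_step:
  assumes "0 \<le> x"
  shows "excess A B x = excess A B (x - 1) + of_bool (x \<in> A) + of_bool (x \<in> B) - 1"
proof -
  have *: "int (card (C \<inter> {0..x})) = int (card (C \<inter> {0..x - 1})) + of_bool (x \<in> C)" for C :: "int set"
  proof -
    have "C \<inter> {x..x} = (if x \<in> C then {x} else {})" by auto
    then show ?thesis using card_window[of x x C] assms by (auto split: if_splits)
  qed
  show ?thesis using *[of A] *[of B] by (simp add: excess_def)
qed

lemma excess_total:
  assumes "A \<subseteq> {0..m}" "B \<subseteq> {0..m}"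
  shows "excess A B m = int (card A) + int (card B) - (m + 1)"
  using assms by (simp add: excess_def Int_absorb2)

lemma excess_growth:
  assumes "-1 \<le> x" "x \<le> y"
  shows "excess A B y \<le> excess A B x + (y - x)"
  using assms(2)
proof (induction y rule: int_ge_induct)
  case (step i)
  then show ?case using excess_step[of "i + 1" A B] assms(1) by (auto simp: of_bool_def)
qed simp

text \<open>Drops of at most one skip no level: the step that crosses from \<open>v\<close> or more
  to below \<open>v\<close> must go from \<open>v\<close> to \<open>v - 1\<close>.\<close>

lemma discrete_descent:
  fixes h :: "int \<Rightarrow> int"
  assumes "y < x" "\<And>z. y < z \<Longrightarrow> z \<le> x \<Longrightarrow> h (z - 1) \<le> h z + 1" "v \<le> h y" "h x < v"
  shows "\<exists>z. y < z \<and> z \<le> x \<and> h (z - 1) = v \<and> h z = v - 1"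
proof -
  have "\<exists>z. y < z \<and> z \<le> x \<and> v \<le> h (z - 1) \<and> h z < v"
    using assms(1,4)
  proof (induction x rule: int_gr_induct)
    case base
    then show ?case using assms(3) by (intro exI[of _ "y + 1"]) auto
  next
    case (step i)
    show ?case
    proof (cases "h i < v")
      case True
      then obtain z where "y < z" "z \<le> i" "v \<le> h (z - 1)" "h z < v" using step.IH by blast
      then show ?thesis by (intro exI[of _ z]) auto
    next
      case False
      then show ?thesis using step by (intro exI[of _ "i + 1"]) auto
    qed
  qed
  then show ?thesis using assms(2) by (smt (verit))
qed

text \<open>The sumset is counted by residues modulo \<open>m\<close>. As \<open>0\<close> and
  \<open>m\<close> lie in \<open>B\<close>, each \<open>a\<close> in \<open>A\<close> contributes
  both \<open>a\<close> and \<open>a + m\<close>, a second hit of its residue; \<open>Z\<close>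
  supplies further second hits.\<close>

lemma card_sumset_ge_residues:
  fixes A B :: "int set"
  assumes A: "A \<subseteq> {0..m}" and B: "B \<subseteq> {0..m}" "0 \<in> B" "m \<in> B"
    and R: "R \<subseteq> {0..<m}" "\<And>z. z \<in> R \<Longrightarrow> z \<in> A + B \<or> z + m \<in> A + B"
    and Z: "Z \<subseteq> {0..<m}" "Z \<inter> A = {}" "\<And>z. z \<in> Z \<Longrightarrow> z \<in> A + B \<and> z + m \<in> A + B"
  shows "card R + card A + card Z \<le> card (A + B)"
proof -
  let ?T = "A + B"
  define T0 where "T0 = {0..<m} \<inter> ?T"
  \<comment> \<open>Unlike \<open>T0\<close>, this admits \<open>m\<close>: it stands for
    \<open>2 * m\<close>, a further multiple of \<open>m\<close> that pays for the possible element
    \<open>m\<close> of \<open>A\<close>.\<close>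
  define T1 where "T1 = {0..m} \<inter> {z. z + m \<in> ?T}"
  have fin: "finite A" "finite B" "finite R" "finite Z" "finite T0" "finite T1"
    using A B(1) R(1) Z(1) by (auto simp: T0_def T1_def intro: finite_subset)
  have AT: "a \<in> ?T" "a + m \<in> ?T" if "a \<in> A" for a
    using set_plus_intro[OF that B(2)] set_plus_intro[OF that B(3)] by simp_all
  have c1: "card T0 + card T1 \<le> card ?T"
  proof -
    have "T0 \<inter> (\<lambda>z. z + m) ` T1 = {}" by (auto simp: T0_def T1_def)
    then have "card (T0 \<union> (\<lambda>z. z + m) ` T1) = card T0 + card T1"
      using fin by (simp add: card_Un_disjoint card_image)
    moreover have "card (T0 \<union> (\<lambda>z. z + m) ` T1) \<le> card ?T"
      using fin by (intro card_mono finite_set_plus) (auto simp: T0_def T1_def)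
    ultimately show ?thesis by simp
  qed
  have c2: "card R + card (A \<inter> {m}) \<le> card (T0 \<union> T1)"
  proof -
    have "card (R \<union> (A \<inter> {m})) = card R + card (A \<inter> {m})"
      using fin R by (intro card_Un_disjoint) auto
    moreover have "R \<union> (A \<inter> {m}) \<subseteq> T0 \<union> T1"
      using R A AT by (fastforce simp: T0_def T1_def)
    ultimately show ?thesis using fin by (metis card_mono finite_UnI)
  qed
  have c3: "card (A \<inter> {0..<m}) + card Z \<le> card (T0 \<inter> T1)"
  proof -
    have "card ((A \<inter> {0..<m}) \<union> Z) = card (A \<inter> {0..<m}) + card Z"
      using fin Z by (intro card_Un_disjoint) auto
    moreover have "(A \<inter> {0..<m}) \<union> Z \<subseteq> T0 \<inter> T1"
      using Z AT by (fastforce simp: T0_def T1_def)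
    ultimately show ?thesis using fin by (metis card_mono finite_Int)
  qed
  have c4: "card A = card (A \<inter> {0..<m}) + card (A \<inter> {m})"
  proof -
    have "A = (A \<inter> {0..<m}) \<union> (A \<inter> {m})" using A by force
    moreover have "(A \<inter> {0..<m}) \<inter> (A \<inter> {m}) = {}" by auto
    ultimately show ?thesis using fin by (metis card_Un_disjoint finite_Int)
  qed
  show ?thesis using c1 c2 c3 c4 card_Un_Int[of T0 T1] fin by simp
qed

locale dense_pair =
  fixes A B :: "int set" and m :: int
  assumes subs: "A \<subseteq> {0..m}" "B \<subseteq> {0..m}"
    and ends: "0 \<in> A" "0 \<in> B" "m \<in> B"
    and dense: "m + 3 \<le> int (card A) + int (card B)"
begin

text \<open>Missing both \<open>z\<close> and \<open>z + m\<close> would force the final level of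
  the walk down to \<open>excess A B (z - 1) <= excess A B z + 1 <= 1\<close>, whereas
  \<open>dense\<close> makes it at least 2.\<close>

lemma residue_covered:
  assumes "0 \<le> z" "z < m"
  shows "z \<in> A + B \<or> z + m \<in> A + B"
proof (rule ccontr)
  assume "\<not> ?thesis"
  then have "excess A B z \<le> 0" "excess A B (z - 1) \<ge> excess A B m"
    using excess_window[of 0 z A B] excess_window[of z m A B] assms by (auto simp: add.commute)
  then show False
    using excess_step[of z A B] excess_total[OF subs] dense assms by (auto simp: of_bool_def split: if_splits)
qed

lemma card_sumset_ge: "m + int (card A) \<le> int (card (A + B))"
proof -
  have "card {0..<m} + card A + card ({} :: int set) \<le> card (A + B)"
    using subs ends residue_covered by (intro card_sumset_ge_residues[of A m B]) auto
  then show ?thesis using ends subs by simp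
qed

context
  assumes small: "card (A + B) + 4 \<le> 2 * card A + card B"
begin

text \<open>Along a descent of the excess from the level of \<open>m\<close> to \<open>0\<close>, each intermediate down-step is a
  residue outside \<open>A \<union> B\<close> that the sumset hits twice, which costs too many elements of \<open>A + B\<close>.\<close>

lemma no_wave:
  assumes "-1 \<le> y" "y < x" "x \<le> m" "excess A B m \<le> excess A B y"
  shows "0 < excess A B x"
proof (rule ccontr)
  assume "\<not> ?thesis"
  then have x0: "excess A B x \<le> 0" by simp
  define F where "F = excess A B m"
  \<comment> \<open>A level of at least 2 before the step keeps the walk positive after it, which
    puts \<open>z\<close> into \<open>A + B\<close>; a level below \<open>F\<close> puts
    \<open>z + m\<close> there.\<close>
  define Z where "Z = {z. y < z \<and> z \<le> x \<and> 2 \<le> excess A B (z - 1) \<and> excess A B (z - 1) < F \<and>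
      excess A B z = excess A B (z - 1) - 1}"
  have F: "F = int (card A) + int (card B) - (m + 1)"
    using excess_total[OF subs] by (simp add: F_def)
  have Zn: "z \<notin> A" "z \<notin> B" "0 \<le> z" "z < m" if "z \<in> Z" for z
  proof -
    have z: "y < z" "z \<le> x" "excess A B z = excess A B (z - 1) - 1"
      using that by (simp_all add: Z_def)
    show z0: "0 \<le> z" using z assms by simp
    show "z \<notin> A" "z \<notin> B"
      using z excess_step[OF z0, of A B] by (simp_all add: of_bool_def split: if_splits)
    then show "z < m" using z assms ends by (cases "z = m") auto
  qed
  have "finite Z" by (rule finite_subset[of _ "{y..x}"]) (auto simp: Z_def)
  have "{2..<F} \<subseteq> (\<lambda>z. excess A B (z - 1)) ` Z"
  proof
    fix v assume v: "v \<in> {2..<F}"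
    have "\<exists>z. y < z \<and> z \<le> x \<and> excess A B (z - 1) = v \<and> excess A B z = v - 1"
    proof (rule discrete_descent[OF assms(2)])
      show "excess A B (z - 1) \<le> excess A B z + 1" if "y < z" for z
        using excess_step[of z A B] that assms(1) by (simp add: of_bool_def)
    qed (use assms(4) v x0 in \<open>simp_all add: F_def\<close>)
    then show "v \<in> (\<lambda>z. excess A B (z - 1)) ` Z" using v by (force simp: Z_def)
  qed
  then have "card {2..<F} \<le> card Z"
    using \<open>finite Z\<close> by (meson card_image_le card_mono finite_imageI le_trans)
  then have cZ: "F - 2 \<le> int (card Z)" by simp
  have "card {0..<m} + card A + card Z \<le> card (A + B)"
  proof (rule card_sumset_ge_residues)
    fix z assume z: "z \<in> Z"
    have "0 + z \<in> A + B" using z Zn[OF z] by (intro excess_window) (auto simp: Z_def)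
    moreover have "z + m \<in> A + B" using z Zn[OF z] by (intro excess_window) (auto simp: Z_def F_def)
    ultimately show "z \<in> A + B \<and> z + m \<in> A + B" by simp
  qed (use subs ends residue_covered Zn in auto)
  \<comment> \<open>The count is m + |A| + (F - 2) = 2|A| + |B| - 3, one more than
    \<open>small\<close> permits.\<close>
  then show False using cZ F small ends subs by simp
qed

text \<open>After its last nonpositive value, at \<open>Max X\<close>, the walk stays above its
  start, which gives the sums from \<open>Max X + 1\<close> to \<open>m\<close>. Before first
  reaching its final level \<open>F\<close>, at \<open>Min Y\<close>, it stays below its end, which
  gives those from \<open>m\<close> to \<open>m + Min Y\<close>. By \<open>no_wave\<close>,
  \<open>Max X\<close> does not exceed \<open>Min Y\<close>, and the climb between them takes at
  least \<open>F\<close> steps; hence the length.\<close>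

lemma long_interval: "\<exists>a. {a..a + int (card A) + int (card B) - 2} \<subseteq> A + B"
proof -
  define F where "F = excess A B m"
  have F: "F = int (card A) + int (card B) - (m + 1)"
    using excess_total[OF subs] by (simp add: F_def)
  have m0: "0 \<le> m" using subs ends by auto
  define X where "X = {x \<in> {-1..m}. excess A B x \<le> 0}"
  define Y where "Y = {y \<in> {-1..m}. F \<le> excess A B y}"
  have XY: "finite X" "finite Y" "X \<noteq> {}" "Y \<noteq> {}"
    using m0 unfolding X_def Y_def F_def
    by (auto intro: finite_subset[of _ "{-1..m}"] exI[of _ "-1"] exI[of _ m])
  have x1: "Max X \<in> X" and y1: "Min Y \<in> Y" using XY by auto
  have lowin: "w \<in> A + B" if "Max X < w" "w \<le> m" for w
  proof -
    have "w \<notin> X" using that XY Max_ge by fastforce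
    moreover have "-1 < w" using that x1 by (auto simp: X_def)
    ultimately have "0 + w \<in> A + B" using that by (intro excess_window) (auto simp: X_def)
    then show ?thesis by simp
  qed
  have upin: "w \<in> A + B" if "m \<le> w" "w \<le> m + Min Y" for w
  proof -
    have "w - m - 1 \<notin> Y" using that XY Min_le by fastforce
    then have "(w - m) + m \<in> A + B"
      using that y1 by (intro excess_window) (auto simp: Y_def F_def)
    then show ?thesis by simp
  qed
  have "Max X \<le> Min Y"
  proof (rule ccontr)
    assume "\<not> ?thesis"
    then have "0 < excess A B (Max X)"
      using x1 y1 by (intro no_wave[of "Min Y"]) (auto simp: X_def Y_def F_def)
    then show False using x1 by (auto simp: X_def)
  qed
  then have "excess A B (Min Y) \<le> excess A B (Max X) + (Min Y - Max X)"
    using x1 by (intro excess_growth) (auto simp: X_def)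
  then have "F \<le> Min Y - Max X" using x1 y1 by (auto simp: X_def Y_def)
  then have "{Max X + 1..Max X + 1 + int (card A) + int (card B) - 2} \<subseteq> A + B"
    using lowin upin F by (smt (verit) atLeastAtMost_iff subsetI)
  then show ?thesis by blast
qed

end

end

section \<open>Cutting and reflecting sets of integers\<close>

lemma card_sumset_ge_trivial:
  fixes A B :: "int set"
  assumes "finite A" "finite B" "A \<noteq> {}" "B \<noteq> {}"
  shows "card A + card B \<le> card (A + B) + 1"
proof -
  let ?X = "(\<lambda>a. a + Min B) ` A" and ?Y = "(\<lambda>b. Max A + b) ` B"
  have "card ?X + card ?Y = card (?X \<union> ?Y) + card (?X \<inter> ?Y)"
    using assms by (intro card_Un_Int) auto
  moreover have "card ?X = card A" "card ?Y = card B"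
    by (auto intro: card_image)
  moreover have "card (?X \<union> ?Y) \<le> card (A + B)"
    using assms set_plus_intro[of _ A "Min B" B] set_plus_intro[of "Max A" A _ B]
    by (intro card_mono finite_set_plus) auto
  moreover have "?X \<inter> ?Y \<subseteq> {Max A + Min B}"
  proof
    fix w assume "w \<in> ?X \<inter> ?Y"
    then obtain a b where "a \<in> A" "b \<in> B" "w = a + Min B" "w = Max A + b" by auto
    moreover have "a \<le> Max A" "Min B \<le> b" using calculation assms by auto
    ultimately show "w \<in> {Max A + Min B}" by auto
  qed
  then have "card (?X \<inter> ?Y) \<le> 1"
    using card_mono[of "{Max A + Min B}" "?X \<inter> ?Y"] by simp
  ultimately show ?thesis by linarith
qed

lemma sumset_translate:
  fixes A B :: "int set"
  shows "(\<lambda>a. a + c) ` A + (\<lambda>b. b + d) ` B = (\<lambda>s. s + (c + d)) ` (A + B)"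
proof -
  have "\<exists>s. (\<exists>a\<in>A. \<exists>b\<in>B. s = a + b) \<and> x + c + (y + d) = s + (c + d)" if "x \<in> A" "y \<in> B" for x y
    using that by (intro exI[of _ "x + y"]) auto
  moreover have "\<exists>a\<in>A. \<exists>b\<in>B. x + y + (c + d) = (a + c) + (b + d)" if "x \<in> A" "y \<in> B" for x y
    using that by (intro bexI[of _ x] bexI[of _ y]) auto
  ultimately show ?thesis by (fastforce simp: set_plus_def image_iff)
qed

lemma sumset_reflect:
  fixes A B :: "int set"
  shows "(\<lambda>a. c - a) ` A + (\<lambda>b. d - b) ` B = (\<lambda>s. (c + d) - s) ` (A + B)"
proof -
  have "\<exists>s. (\<exists>a\<in>A. \<exists>b\<in>B. s = a + b) \<and> c - x + (d - y) = c + d - s" if "x \<in> A" "y \<in> B" for x y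
    using that by (intro exI[of _ "x + y"]) auto
  moreover have "\<exists>a\<in>A. \<exists>b\<in>B. c + d - (x + y) = (c - a) + (d - b)" if "x \<in> A" "y \<in> B" for x y
    using that by (intro bexI[of _ x] bexI[of _ y]) auto
  ultimately show ?thesis by (fastforce simp: set_plus_def image_iff)
qed

text \<open>If the two partial sumsets exhausted \<open>A + A\<close>, every element of \<open>A\<close> below \<open>b\<close> would be congruent
  to \<open>b\<close> modulo the gap below \<open>b\<close>; this gap is at least \<open>2\<close>, while \<open>0\<close> and \<open>1\<close> are in \<open>A\<close>.\<close>

lemma card_sumset_ge_split:
  fixes A :: "int set"
  assumes A: "finite A" "0 \<in> A" "1 \<in> A" "b \<in> A" "b - 1 \<notin> A"
    and l: "0 < b" "b < l" "l \<in> A"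
  shows "card (A \<inter> {..b} + A \<inter> {..b}) + card (A \<inter> {b..} + A \<inter> {b..}) \<le> card (A + A)"
proof -
  define L where "L = A \<inter> {..b}"
  define U where "U = A \<inter> {b..}"
  have fin: "finite L" "finite U" "finite (L + L)" "finite (U + U)"
    using A by (auto simp: L_def U_def intro!: finite_set_plus)
  have Lle: "w \<le> 2 * b" if "w \<in> L + L" for w
    using that by (auto simp: L_def elim!: set_plus_elim)
  have Uge: "2 * b \<le> w" if "w \<in> U + U" for w
    using that by (auto simp: U_def elim!: set_plus_elim)
  have "\<exists>x y. x \<in> L \<and> y \<in> U \<and> x + y \<notin> (L + L) \<union> (U + U)"
  proof (rule ccontr)
    assume "\<not> ?thesis"
    then have H: "x + y \<in> L + L \<or> x + y \<in> U + U" if "x \<in> L" "y \<in> U" for x y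
      using that by blast
    define u where "u = Max (A \<inter> {..<b})"
    define v where "v = Min (A \<inter> {b<..})"
    have fne: "finite (A \<inter> {..<b})" "A \<inter> {..<b} \<noteq> {}" "finite (A \<inter> {b<..})" "A \<inter> {b<..} \<noteq> {}"
      using A l by auto
    have u: "u \<in> A" "u < b" and v: "v \<in> A" "b < v"
      using Max_in[OF fne(1,2)] Min_in[OF fne(3,4)] by (auto simp: u_def v_def)
    have umax: "x \<le> u" if "x \<in> A" "x < b" for x
      using that fne by (auto simp: u_def)
    have vmin: "v \<le> x" if "x \<in> A" "b < x" for x
      using that fne by (auto simp: v_def)
    have uL: "u \<in> L" and vU: "v \<in> U"
      using u v A by (auto simp: L_def U_def)
    \<comment> \<open>\<open>u\<close>, \<open>b\<close>, \<open>v\<close> are neighbours in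
      \<open>A\<close>. A sum of two elements of \<open>L\<close> that equals \<open>u + v\<close>
      cannot use an element up to \<open>u\<close>, as the other would be at least
      \<open>v > b\<close>; so it is \<open>b + b\<close>. The same holds for
      \<open>U\<close>.\<close>
    have uv: "u + v = 2 * b"
    proof (rule ccontr)
      assume ne: "u + v \<noteq> 2 * b"
      from H[OF uL vU] show False
      proof
        assume "u + v \<in> L + L"
        then obtain x y where xy: "x \<in> L" "y \<in> L" "u + v = x + y" by (elim set_plus_elim)
        then have "x = b \<or> x \<le> u" "y = b \<or> y \<le> u" "x \<le> b" "y \<le> b"
          using umax by (force simp: L_def)+
        then show False using xy ne v u by auto
      next
        assume "u + v \<in> U + U"
        then obtain x y where xy: "x \<in> U" "y \<in> U" "u + v = x + y" by (elim set_plus_elim)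
        then have "x = b \<or> v \<le> x" "y = b \<or> v \<le> y" "b \<le> x" "b \<le> y"
          using vmin by (force simp: U_def)+
        then show False using xy ne v u by auto
      qed
    qed
    define \<delta> where "\<delta> = b - u"
    have "u \<noteq> b - 1" using A u by auto
    then have \<delta>2: "2 \<le> \<delta>" using u by (simp add: \<delta>_def)
    \<comment> \<open>For \<open>x < u\<close> the sum \<open>x + v\<close> is below
      \<open>2 * b\<close>, so it equals some \<open>y + z\<close> with \<open>y\<close>,
      \<open>z\<close> in \<open>L\<close>. Both are less than \<open>v\<close>, hence both exceed
      \<open>x\<close>, and induction on the distance to \<open>b\<close> applies.\<close>
    have dL: "\<delta> dvd b - x" if "x \<in> L" for x
      using that
    proof (induction "nat (b - x)" arbitrary: x rule: less_induct)
      case less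
      show ?case
      proof (cases "x = b \<or> x = u")
        case False
        then have "x < b" "x < u" using less.prems umax[of x] by (auto simp: L_def)
        then have "\<not> 2 * b \<le> x + v" using uv by simp
        then have "x + v \<in> L + L" using H[OF less.prems vU] Uge by blast
        then obtain y z where yz: "y \<in> L" "z \<in> L" "x + v = y + z" by (elim set_plus_elim)
        then have "y \<le> b" "z \<le> b" by (auto simp: L_def)
        then have "x < y" "x < z" using yz v by auto
        then have "\<delta> dvd b - y" "\<delta> dvd b - z"
          using less.hyps[of y] less.hyps[of z] yz \<open>x < b\<close> by auto
        then have "\<delta> dvd (b - y) + (b - z) + \<delta>" by (intro dvd_add) auto
        also have "(b - y) + (b - z) + \<delta> = b - x" using yz uv by (simp add: \<delta>_def)
        finally show ?thesis .
      qed (auto simp: \<delta>_def)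
    qed
    have "0 \<in> L" "1 \<in> L" using A l by (auto simp: L_def)
    then have "\<delta> dvd b" "\<delta> dvd b - 1" using dL by force+
    then have "\<delta> dvd b - (b - 1)" by (rule dvd_diff)
    then show False using \<delta>2 by simp
  qed
  then obtain x y where xy: "x \<in> L" "y \<in> U" "x + y \<notin> (L + L) \<union> (U + U)" by blast
  \<comment> \<open>The possible common point of the two sumsets is made up for by the mixed sum
    \<open>x + y\<close>.\<close>
  have "(L + L) \<inter> (U + U) \<subseteq> {2 * b}" using Lle Uge by (auto intro: order_antisym)
  then have "card ((L + L) \<inter> (U + U)) \<le> 1"
    using card_mono[of "{2 * b}"] by fastforce
  then have "card (L + L) + card (U + U) \<le> card ((L + L) \<union> (U + U)) + 1"
    using card_Un_Int[OF fin(3,4)] by simp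
  also have "\<dots> = card (insert (x + y) ((L + L) \<union> (U + U)))"
    using xy fin by simp
  also have "\<dots> \<le> card (A + A)"
  proof (rule card_mono)
    show "finite (A + A)" using A by (intro finite_set_plus)
    have "L \<subseteq> A" "U \<subseteq> A" by (auto simp: L_def U_def)
    then show "insert (x + y) ((L + L) \<union> (U + U)) \<subseteq> A + A"
      using xy by (auto intro: set_plus_intro dest: set_plus_mono2[of L A L A, THEN subsetD]
          set_plus_mono2[of U A U A, THEN subsetD])
  qed
  finally show ?thesis by (simp add: L_def U_def)
qed

lemma excess_translate:
  assumes "0 \<le> b" "-1 \<le> x"
  shows "excess ((\<lambda>a. a - b) ` (A \<inter> {b..})) ((\<lambda>a. a - b) ` (B \<inter> {b..})) x =
    excess A B (b + x) - excess A B (b - 1)"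
proof -
  have "card ((\<lambda>a. a - b) ` (C \<inter> {b..}) \<inter> {0..x}) = card (C \<inter> {b..b + x})" for C :: "int set"
  proof -
    have "(\<lambda>a. a - b) ` (C \<inter> {b..}) \<inter> {0..x} = (\<lambda>a. a - b) ` (C \<inter> {b..b + x})" by auto
    then show ?thesis by (simp add: card_image)
  qed
  then show ?thesis
    using assms card_window[of b "b + x" A] card_window[of b "b + x" B] by (simp add: excess_def)
qed

text \<open>Reflection runs the walk backwards from its end, so that a statement about one end of a
  set serves for the other.\<close>

lemma excess_reflect:
  assumes "A \<subseteq> {0..l}" "B \<subseteq> {0..l}" "-1 \<le> x" "x \<le> l"
  shows "excess ((\<lambda>a. l - a) ` A) ((\<lambda>a. l - a) ` B) x = excess A B l - excess A B (l - x - 1)"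
proof -
  have "card ((\<lambda>a. l - a) ` C \<inter> {0..x}) = card (C \<inter> {l - x..l})" for C :: "int set"
  proof -
    have "(\<lambda>a. l - a) ` C \<inter> {0..x} = (\<lambda>a. l - a) ` (C \<inter> {l - x..l})" by auto
    then show ?thesis by (simp add: card_image inj_on_def)
  qed
  then show ?thesis
    using assms card_window[of "l - x" l A] card_window[of "l - x" l B] by (simp add: excess_def)
qed

section \<open>Freiman's structure theorem for sets of integers\<close>

definition normal_small_doubling :: "int set \<Rightarrow> int \<Rightarrow> bool" where
  "normal_small_doubling A l \<longleftrightarrow> A \<subseteq> {0..l} \<and> 0 \<in> A \<and> l \<in> A \<and> Gcd A = 1 \<and>
     card (A + A) + 4 \<le> 3 * card A"

lemma normal_small_doubling_reflect:
  assumes "normal_small_doubling A l"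
  shows "normal_small_doubling ((\<lambda>a. l - a) ` A) l"
proof -
  have inj: "inj_on ((-) c) S" for c :: int and S by (simp add: inj_on_def)
  have "Gcd ((\<lambda>a. l - a) ` A) dvd a" if "a \<in> A" for a
  proof -
    have "Gcd ((\<lambda>a. l - a) ` A) dvd l - 0" "Gcd ((\<lambda>a. l - a) ` A) dvd l - a"
      using assms that by (intro Gcd_dvd imageI; simp add: normal_small_doubling_def)+
    then have "Gcd ((\<lambda>a. l - a) ` A) dvd (l - 0) - (l - a)" by (rule dvd_diff)
    then show ?thesis by simp
  qed
  then have "Gcd ((\<lambda>a. l - a) ` A) dvd Gcd A" by (rule Gcd_greatest)
  then have "Gcd ((\<lambda>a. l - a) ` A) = 1"
    using assms by (simp add: normal_small_doubling_def)
  moreover have "card ((\<lambda>a. l - a) ` A + (\<lambda>a. l - a) ` A) = card (A + A)"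
    by (simp add: sumset_reflect card_image[OF inj])
  moreover have "card ((\<lambda>a. l - a) ` A) = card A" by (rule card_image[OF inj])
  ultimately show ?thesis
    using assms by (auto simp: normal_small_doubling_def)
qed

lemma Gcd_eq_1_if_consecutive:
  fixes A :: "int set"
  assumes "x \<in> A" "y \<in> A" "y = x + 1"
  shows "Gcd A = 1"
proof -
  have "Gcd A dvd y - x" using assms by (intro dvd_diff Gcd_dvd)
  then show ?thesis using assms by simp
qed

text \<open>A counterexample of least cardinality to \<open>normal_small_doubling_dense\<close>,
  with \<open>sparse\<close> the negated bound; the locale is led to
  \<open>contradiction\<close>.\<close>

locale minimal_sparse =
  fixes A :: "int set" and l :: int
  assumes nsd: "normal_small_doubling A l"
    and sparse: "2 * int (card A) - 3 \<le> l"
    and minimal: "\<And>B m. card B < card A \<Longrightarrow> normal_small_doubling B m \<Longrightarrow> m \<le> 2 * int (card B) - 4"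
begin

lemma A_props: "A \<subseteq> {0..l}" "0 \<in> A" "l \<in> A" "Gcd A = 1" "card (A + A) + 4 \<le> 3 * card A"
  using nsd by (auto simp: normal_small_doubling_def)

lemma finite_A: "finite A" using A_props(1) finite_subset by blast

lemma card_A: "3 \<le> card A"
  using card_sumset_ge_trivial[of A A] A_props finite_A by fastforce

lemma reflect: "minimal_sparse ((\<lambda>a. l - a) ` A) l"
proof
  have "card ((\<lambda>a. l - a) ` A) = card A" by (intro card_image) (simp add: inj_on_def)
  then show "2 * int (card ((\<lambda>a. l - a) ` A)) - 3 \<le> l"
    "\<And>B m. card B < card ((\<lambda>a. l - a) ` A) \<Longrightarrow> normal_small_doubling B m \<Longrightarrow> m \<le> 2 * int (card B) - 4"
    using sparse minimal by auto
  show "normal_small_doubling ((\<lambda>a. l - a) ` A) l" using nsd by (rule normal_small_doubling_reflect)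
qed

text \<open>The residues of \<open>A\<close> are hit twice, so a sumset of size at most 3|A| - 4 has
  room for only 2|A| - 4 residues modulo \<open>l\<close>. By \<open>sparse\<close>, some residue is
  missed.\<close>

lemma few_residues:
  assumes "R \<subseteq> {0..<l}" "\<And>z. z \<in> R \<Longrightarrow> z \<in> A + A \<or> z + l \<in> A + A"
  shows "int (card R) \<le> 2 * int (card A) - 4"
proof -
  have "card R + card A + card ({} :: int set) \<le> card (A + A)"
    using assms A_props by (intro card_sumset_ge_residues[of A l A]) auto
  then show ?thesis using A_props(5) by simp
qed

text \<open>These 2|A| - 3 <= l consecutive integers have distinct residues modulo \<open>l\<close>,
  one more than \<open>few_residues\<close> permits.\<close>

lemma no_long_interval: "\<not> {a..a + 2 * int (card A) - 4} \<subseteq> A + A"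
proof
  let ?I = "{a..a + 2 * int (card A) - 4}"
  assume I: "?I \<subseteq> A + A"
  have l: "0 < l" using sparse card_A by simp
  have inj: "inj_on (\<lambda>w. w mod l) ?I"
  proof (rule inj_onI)
    fix x y assume *: "x \<in> ?I" "y \<in> ?I" "x mod l = y mod l"
    then have "l dvd x - y" by (simp add: mod_eq_dvd_iff)
    moreover have "\<bar>x - y\<bar> < l" using * sparse by auto
    ultimately show "x = y" using zdvd_not_zless[of "\<bar>x - y\<bar>" l] by fastforce
  qed
  have "int (card ((\<lambda>w. w mod l) ` ?I)) \<le> 2 * int (card A) - 4"
  proof (rule few_residues)
    show "(\<lambda>w. w mod l) ` ?I \<subseteq> {0..<l}" using l by auto
    fix z assume "z \<in> (\<lambda>w. w mod l) ` ?I"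
    then obtain w where w: "w \<in> A + A" "z = w mod l" using I by auto
    obtain x y where "w = x + y" "x \<in> A" "y \<in> A" using w(1) by (elim set_plus_elim)
    moreover have "0 \<le> x" "x \<le> l" "0 \<le> y" "y \<le> l" using calculation A_props(1) by auto
    ultimately have "0 \<le> w" "w \<le> 2 * l" by simp_all
    then consider "w < l" | "l \<le> w" "w < 2 * l" | "w = 2 * l" by linarith
    then show "z \<in> A + A \<or> z + l \<in> A + A"
    proof cases
      case 2
      then have "w mod l = w - l" using int_mod_pos_eq[of w l 1 "w - l"] by simp
      then show ?thesis using w by simp
    next
      case 3
      then show ?thesis using w set_plus_intro[OF A_props(2,2)] by simp
    qed (use w \<open>0 \<le> w\<close> in auto)
  qed
  moreover have "card ((\<lambda>w. w mod l) ` ?I) = card ?I" by (rule card_image[OF inj])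
  ultimately show False using card_A by simp
qed

text \<open>Without \<open>1\<close>, remove \<open>0\<close>. If the rest lies in one residue
  class, its sums, its elements and \<open>0\<close> are too many. Otherwise three sums are lost, so
  the rest has small doubling, is dense by minimality and yields a forbidden interval. The purpose
  of the lemma and its mirror image is that both sides of a cut have gcd 1.\<close>

lemma one_mem: "1 \<in> A"
proof (rule ccontr)
  assume no1: "1 \<notin> A"
  define A2 where "A2 = A - {0}"
  define a1 where "a1 = Min A2"
  define V where "V = (\<lambda>a. a - a1) ` A2"
  have l: "0 < l" using sparse card_A by simp
  have A2: "finite A2" "A2 \<subseteq> A" "l \<in> A2" "card A2 = card A - 1"
    using finite_A A_props l by (auto simp: A2_def)
  have a1: "a1 \<in> A2" unfolding a1_def using A2 by (intro Min_in) auto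
  have a1_le: "a1 \<le> a" if "a \<in> A2" for a using A2 that by (simp add: a1_def)
  have "0 \<le> a1" "a1 \<noteq> 0" "a1 \<noteq> 1" using a1 A2 A_props no1 by (auto simp: A2_def)
  then have a12: "2 \<le> a1" by linarith
  have TA: "A2 + A2 \<subseteq> A + A" using A2 by (intro set_plus_mono2)
  have TA2: "2 * a1 \<le> w" if "w \<in> A2 + A2" for w
  proof -
    from that obtain x y where "w = x + y" "x \<in> A2" "y \<in> A2" by (elim set_plus_elim)
    then show ?thesis using a1_le[of x] a1_le[of y] by simp
  qed
  have AA: "A \<subseteq> A + A" using set_plus_intro[OF A_props(2)] by force
  have fin: "finite (A + A)" "finite (A2 + A2)" using finite_A A2 by (auto intro: finite_set_plus)
  have unit: "d dvd 1" if "\<And>a. a \<in> A2 \<Longrightarrow> d dvd a" for d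
  proof -
    have "d dvd a" if "a \<in> A" for a
      using that \<open>\<And>a. a \<in> A2 \<Longrightarrow> d dvd a\<close> by (cases "a = 0") (auto simp: A2_def)
    then have "d dvd Gcd A" by (rule Gcd_greatest)
    then show ?thesis using A_props by simp
  qed
  have cV: "card V = card A - 1" using A2 unfolding V_def by (subst card_image) auto
  have V_alt: "V = (\<lambda>a. a + (- a1)) ` A2" by (simp add: V_def)
  have VV: "V + V = (\<lambda>s. s + (- a1 + - a1)) ` (A2 + A2)"
    unfolding V_alt by (rule sumset_translate)
  then have cVV: "card (V + V) = card (A2 + A2)" by (simp add: card_image inj_on_def)
  show False
  proof (cases "Gcd V = 1")
    case False
    define d where "d = Gcd V"
    have d: "d dvd a - a1" if "a \<in> A2" for a unfolding d_def V_def using that by (intro Gcd_dvd) auto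
    have nd: "\<not> d dvd a1"
    proof
      assume *: "d dvd a1"
      have "d dvd a" if "a \<in> A2" for a using dvd_add[OF d[OF that] *] by simp
      then have "d dvd 1" by (rule unit)
      then show False using False by (simp add: d_def)
    qed
    \<comment> \<open>Modulo \<open>d\<close> the elements of \<open>A2\<close> are all
      \<open>a1\<close> and their sums all \<open>2 * a1\<close>, which differ as \<open>d\<close>
      does not divide \<open>a1\<close>.\<close>
    have disj: "(A2 + A2) \<inter> A2 = {}"
    proof (rule ccontr)
      assume "\<not> ?thesis"
      then obtain w where w: "w \<in> A2 + A2" "w \<in> A2" by blast
      from w(1) obtain x y where "w = x + y" "x \<in> A2" "y \<in> A2" by (elim set_plus_elim)
      then have xy: "x \<in> A2" "y \<in> A2" "x + y \<in> A2" using w by simp_all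
      have "d dvd (x + y - a1) - ((x - a1) + (y - a1))"
        by (rule dvd_diff[OF d[OF xy(3)] dvd_add[OF d[OF xy(1)] d[OF xy(2)]]])
      then show False using nd by simp
    qed
    have "0 \<notin> (A2 + A2) \<union> A2" using TA2 a12 by (force simp: A2_def)
    then have "card (insert 0 ((A2 + A2) \<union> A2)) = card (A2 + A2) + card A2 + 1"
      using fin A2 disj by (simp add: card_Un_disjoint)
    moreover have "card (insert 0 ((A2 + A2) \<union> A2)) \<le> card (A + A)"
      using fin TA AA A2 A_props by (intro card_mono) auto
    moreover have "card A2 + card A2 \<le> card (A2 + A2) + 1"
      using A2 by (intro card_sumset_ge_trivial) auto
    ultimately show False using A2 A_props(5) card_A by simp
  next
    case True
    \<comment> \<open>If every element but \<open>a1\<close> were a sum of two smaller ones, all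
      would be multiples of \<open>a1 >= 2\<close>.\<close>
    have "\<exists>a \<in> A2. a \<noteq> a1 \<and> a \<notin> A2 + A2"
    proof (rule ccontr)
      assume "\<not> ?thesis"
      then have H: "a \<in> A2 + A2" if "a \<in> A2" "a \<noteq> a1" for a using that by blast
      have "a1 dvd a" if "a \<in> A2" for a
        using that
      proof (induction "nat a" arbitrary: a rule: less_induct)
        case less
        show ?case
        proof (cases "a = a1")
          case False
          then obtain x y where xy: "x \<in> A2" "y \<in> A2" "a = x + y"
            using H[OF less.prems] by (auto elim: set_plus_elim)
          then have "0 < x" "0 < y" using a1_le a12 by force+
          then have "a1 dvd x" "a1 dvd y" using less.hyps xy by auto
          then show ?thesis using xy by simp
        qed simp
      qed
      then have "a1 dvd 1" by (rule unit)
      then show False using a12 by simp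
    qed
    then obtain c where c: "c \<in> A2" "c \<noteq> a1" "c \<notin> A2 + A2" by blast
    have "a1 \<notin> A2 + A2" "0 \<notin> A2 + A2" "c \<noteq> 0" "a1 \<noteq> 0"
      using TA2 a12 c by (force simp: A2_def)+
    \<comment> \<open>Three sums are lost for one element, which is exactly what preserves small
      doubling.\<close>
    then have "card (insert 0 (insert a1 (insert c (A2 + A2)))) = card (A2 + A2) + 3"
      using c fin by simp
    moreover have "card (insert 0 (insert a1 (insert c (A2 + A2)))) \<le> card (A + A)"
      using fin TA AA A2 A_props c a1 by (intro card_mono) auto
    ultimately have small: "card (V + V) + 4 \<le> 3 * card V"
      using A_props(5) cV cVV card_A by simp
    have Vsub: "V \<subseteq> {0..l - a1}" "0 \<in> V" "l - a1 \<in> V"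
      using a1_le A2 A_props(1) a1 by (auto simp: V_def)
    have "l - a1 \<le> 2 * int (card V) - 4"
      using Vsub True small cV card_A by (intro minimal) (auto simp: normal_small_doubling_def)
    then interpret V: dense_pair V V "l - a1"
      using Vsub by unfold_locales auto
    obtain a where a: "{a..a + int (card V) + int (card V) - 2} \<subseteq> V + V"
      using V.long_interval small by auto
    have "{a + 2 * a1..a + 2 * a1 + 2 * int (card A) - 4} \<subseteq> A + A"
    proof
      fix w assume "w \<in> {a + 2 * a1..a + 2 * a1 + 2 * int (card A) - 4}"
      then have "w - 2 * a1 \<in> V + V" using a cV card_A by auto
      then have "w \<in> A2 + A2" by (auto simp: VV)
      then show "w \<in> A + A" using TA by blast
    qed
    then show False using no_long_interval by blast
  qed
qed

lemma pred_l_mem: "l - 1 \<in> A"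
proof -
  interpret refl: minimal_sparse "(\<lambda>a. l - a) ` A" l by (rule reflect)
  show ?thesis using refl.one_mem by (auto simp: algebra_simps)
qed

text \<open>Cut at \<open>b\<close>. As the walk is not positive at \<open>b - 1\<close>, the lower
  part \<open>L\<close> is too sparse to have small doubling, by minimality; so |L + L| >= 3|L| - 3.
  By \<open>card_sumset_ge_split\<close> the upper part then has small doubling, hence is dense, and
  \<open>no_wave\<close> applies to its walk.\<close>

lemma no_wave_above:
  assumes b: "b \<in> A" "b - 1 \<notin> A" "0 < b" "b < l" "excess A A (b - 1) \<le> 0"
    and xy: "b - 1 \<le> y" "y < x" "x \<le> l" "excess A A l \<le> excess A A y"
  shows "excess A A (b - 1) < excess A A x"
proof -
  define L where "L = A \<inter> {..b}"
  define U where "U = A \<inter> {b..}"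
  define V where "V = (\<lambda>a. a - b) ` U"
  have fin: "finite L" "finite U" using finite_A by (auto simp: L_def U_def)
  have split: "card (L + L) + card (U + U) \<le> card (A + A)"
    unfolding L_def U_def using finite_A A_props one_mem b by (intro card_sumset_ge_split[where l = l]) auto
  have "L \<union> U = A" "L \<inter> U = {b}" using b by (auto simp: L_def U_def)
  then have cLU: "card L + card U = card A + 1"
    using card_Un_Int[OF fin] by simp
  have "l \<in> A - L" "0 \<in> A - U" "L \<subseteq> A" "U \<subseteq> A" using b A_props by (auto simp: L_def U_def)
  then have "L \<subset> A" "U \<subset> A" by blast+
  then have lt: "card L < card A" "card U < card A" using finite_A by (auto intro: psubset_card_mono)
  have "L = insert b (A \<inter> {0..b - 1})" using b A_props(1) by (auto simp: L_def)
  then have cL: "card L = card (A \<inter> {0..b - 1}) + 1" by simp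
  have "3 * card L \<le> card (L + L) + 3"
  proof (rule ccontr)
    assume "\<not> ?thesis"
    then have "normal_small_doubling L b"
      using A_props b one_mem Gcd_eq_1_if_consecutive[of 0 L 1]
      by (auto simp: normal_small_doubling_def L_def)
    then have "b \<le> 2 * int (card L) - 4" using lt by (intro minimal)
    then show False using b(5) cL by (simp add: excess_def)
  qed
  then have small: "card (U + U) + 4 \<le> 3 * card U" using split cLU A_props(5) by simp
  have V_alt: "V = (\<lambda>a. a + (- b)) ` U" by (simp add: V_def)
  have "V + V = (\<lambda>s. s + (- b + - b)) ` (U + U)"
    unfolding V_alt by (rule sumset_translate)
  then have cVV: "card (V + V) = card (U + U)" by (simp add: card_image inj_on_def)
  have cV: "card V = card U" unfolding V_def by (simp add: card_image)
  have "l - b \<in> V" "l - 1 - b \<in> V"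
    using pred_l_mem A_props b unfolding V_def U_def by auto
  then have "Gcd V = 1" by (intro Gcd_eq_1_if_consecutive[of "l - 1 - b" V "l - b"]) auto
  moreover have Vsub: "V \<subseteq> {0..l - b}" "0 \<in> V"
    using A_props(1) b by (auto simp: V_def U_def)
  ultimately have "normal_small_doubling V (l - b)"
    using \<open>l - b \<in> V\<close> small cV cVV by (auto simp: normal_small_doubling_def)
  then have "l - b \<le> 2 * int (card V) - 4" using lt cV by (intro minimal) auto
  then interpret V: dense_pair V V "l - b"
    using Vsub \<open>l - b \<in> V\<close> by unfold_locales auto
  have ex: "excess V V z = excess A A (b + z) - excess A A (b - 1)" if "-1 \<le> z" for z
    unfolding V_def U_def using b that by (intro excess_translate) auto
  have "0 < excess V V (x - b)"
    using small cV cVV xy b ex[of "y - b"] ex[of "l - b"] by (intro V.no_wave[of "y - b"]) auto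
  then show ?thesis using ex[of "x - b"] xy by simp
qed

text \<open>This is \<open>no_wave_above\<close> for the reflected set, cut at
  \<open>l - a\<close>.\<close>

lemma no_wave_below:
  assumes a: "a \<in> A" "a + 1 \<notin> A" "0 < a" "a < l" "excess A A l \<le> excess A A a"
    and xy: "-1 \<le> x" "x < y" "y \<le> a" "excess A A y \<le> 0"
  shows "excess A A x < excess A A a"
proof -
  let ?A' = "(\<lambda>a. l - a) ` A"
  interpret refl: minimal_sparse ?A' l by (rule reflect)
  have ex: "excess ?A' ?A' z = excess A A l - excess A A (l - z - 1)" if "-1 \<le> z" "z \<le> l" for z
    using that A_props by (intro excess_reflect) auto
  have "excess ?A' ?A' (l - a - 1) < excess ?A' ?A' (l - x - 1)"
  proof (rule refl.no_wave_above[of "l - a" "l - y - 1" "l - x - 1"])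
    show "l - a - 1 \<notin> ?A'" using a(2) by (auto simp: algebra_simps)
  qed (use a xy ex[of "l - a - 1"] ex[of l] ex[of "l - y - 1"] in auto)
  then show ?thesis using ex[of "l - a - 1"] ex[of "l - x - 1"] a xy by auto
qed

text \<open>A residue \<open>z\<close> missed by \<open>A + A\<close> is a down-step of the excess from one of the \<open>2 - excess A A l\<close>
  values in \<open>{excess A A l..1}\<close>. More residues than that are missed, so two of them, \<open>z < z'\<close>, have the
  same value. Splitting \<open>A\<close> at the first maximum \<open>a\<close> of the excess in between and after its last
  minimum \<open>c\<close> before \<open>a\<close> shows that \<open>A + A\<close> contains \<open>{a..2 * a}\<close> and
  \<open>{2 * (c + 1)..c + 1 + l}\<close>, hence \<open>z'\<close> or \<open>z + l\<close>.\<close>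

lemma contradiction: False
proof -
  let ?f = "excess A A" and ?T = "A + A"
  have l: "0 < l" using sparse card_A by simp
  have fl: "?f l = 2 * int (card A) - l - 1" using excess_total[of A l A] A_props by simp
  have step: "?f z = (if z \<in> A then ?f (z - 1) + 1 else ?f (z - 1) - 1)" if "0 \<le> z" for z
    using excess_step[OF that, of A A] by (simp add: of_bool_def)
  define R where "R = {0..<l} \<inter> {z. z \<in> ?T \<or> z + l \<in> ?T}"
  define Bad where "Bad = {0..<l} - R"
  have "int (card R) \<le> 2 * int (card A) - 4" by (intro few_residues) (auto simp: R_def)
  moreover have "card Bad = card {0..<l} - card R"
    unfolding Bad_def by (intro card_Diff_subset) (auto simp: R_def)
  ultimately have cBad: "3 - ?f l \<le> int (card Bad)" using fl l by simp
  have bad: "0 \<le> z" "z < l" "z \<notin> A" "z \<notin> ?T" "z + l \<notin> ?T" "?f z \<le> 0" "?f l \<le> ?f (z - 1)"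
    if "z \<in> Bad" for z
  proof -
    show z: "0 \<le> z" "z < l" "z \<notin> ?T" "z + l \<notin> ?T" using that by (auto simp: Bad_def R_def)
    then show "z \<notin> A" using set_plus_intro[OF A_props(2), of z A] by auto
    show "?f z \<le> 0" "?f l \<le> ?f (z - 1)"
      using z excess_window[of 0 z A A] excess_window[of z l A A] by auto
  qed
  have "(\<lambda>z. ?f (z - 1)) ` Bad \<subseteq> {?f l..1}" using bad step by force
  then have "card ((\<lambda>z. ?f (z - 1)) ` Bad) \<le> card {?f l..1}" by (intro card_mono) auto
  also have "\<dots> < card Bad" using cBad fl sparse by simp
  finally have "\<not> inj_on (\<lambda>z. ?f (z - 1)) Bad" by (rule pigeonhole)
  then obtain z z' where zz: "z \<in> Bad" "z' \<in> Bad" "?f (z - 1) = ?f (z' - 1)" "z < z'"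
    unfolding inj_on_def by (metis linorder_neqE)
  note bz = bad[OF zz(1)] and bz' = bad[OF zz(2)]
  define v where "v = ?f (z - 1)"
  have v: "?f (z' - 1) = v" "?f z = v - 1" "v \<le> 1" "?f l \<le> v"
    using zz bz step[of z] by (auto simp: v_def)
  have "z \<noteq> z' - 1" using v by auto
  then have zz1: "z < z' - 1" using zz by simp

  define M where "M = Max (?f ` {z..z' - 1})"
  have M_ge: "?f x \<le> M" if "z \<le> x" "x \<le> z' - 1" for x
    using that by (simp add: M_def)
  have "M \<in> ?f ` {z..z' - 1}" unfolding M_def using zz1 by (intro Max_in) auto
  define P where "P = {z..z' - 1} \<inter> {x. ?f x = M}"
  have "finite P" unfolding P_def by simp
  have "P \<noteq> {}" using \<open>M \<in> _\<close> by (auto simp: P_def)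
  define a where "a = Min P"
  have "a \<in> P" unfolding a_def using \<open>finite P\<close> \<open>P \<noteq> {}\<close> by (rule Min_in)
  then have a: "z \<le> a" "a \<le> z' - 1" "?f a = M" by (auto simp: P_def)
  have a_first: "?f x < M" if "z \<le> x" "x < a" for x
  proof -
    have "x \<notin> P" using that(2) Min_le[OF \<open>finite P\<close>, of x] unfolding a_def by linarith
    then show ?thesis using that a M_ge[of x] by (auto simp: P_def)
  qed
  have Mv: "v \<le> M" using M_ge[of "z' - 1"] v zz1 by simp
  have "a \<noteq> z" using v a Mv by auto
  then have za: "z < a" using a by simp
  have aA: "a \<in> A"
    using step[of a] a_first[of "a - 1"] a za bz by (auto split: if_splits)
  have a1A: "a + 1 \<notin> A"
  proof (cases "a = z' - 1")
    case False
    then show ?thesis using M_ge[of "a + 1"] a step[of "a + 1"] bz by (auto split: if_splits)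
  qed (use bz' in auto)

  define m where "m = Min (?f ` {z..a})"
  have m_le: "m \<le> ?f x" if "z \<le> x" "x \<le> a" for x
    using that by (simp add: m_def)
  have "m \<in> ?f ` {z..a}" unfolding m_def using za by (intro Min_in) auto
  define Q where "Q = {z..a} \<inter> {x. ?f x = m}"
  have "finite Q" unfolding Q_def by simp
  have "Q \<noteq> {}" using \<open>m \<in> _\<close> by (auto simp: Q_def)
  define c where "c = Max Q"
  have "c \<in> Q" unfolding c_def using \<open>finite Q\<close> \<open>Q \<noteq> {}\<close> by (rule Max_in)
  then have c: "z \<le> c" "c \<le> a" "?f c = m" by (auto simp: Q_def)
  have c_last: "m < ?f x" if "c < x" "x \<le> a" for x
  proof -
    have "x \<notin> Q" using that(1) Max_ge[OF \<open>finite Q\<close>, of x] unfolding c_def by linarith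
    then show ?thesis using that c m_le[of x] by (auto simp: Q_def)
  qed
  have mv: "m \<le> v - 1" using m_le[of z] v za by simp
  then have "c \<noteq> a" using a c Mv by auto
  then have ca: "c < a" using c by simp
  have c1A: "c + 1 \<in> A"
    using step[of "c + 1"] c_last[of "c + 1"] c ca bz by (auto split: if_splits)
  have cA: "c \<notin> A"
  proof (cases "c = z")
    case False
    then show ?thesis using m_le[of "c - 1"] c step[of c] bz ca by (auto split: if_splits)
  qed (use bz in auto)

  \<comment> \<open>Up to \<open>a\<close> this is the choice of \<open>c\<close>. Beyond,
    \<open>no_wave_above\<close> applies with the cut at \<open>c + 1\<close> and the high point
    \<open>a\<close>, because \<open>m <= v - 1 <= 0\<close> and the final level is at most
    \<open>v <= M\<close>. \<open>below\<close> is symmetric.\<close>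
  have above: "m < ?f x" if "c < x" "x \<le> l" for x
  proof (cases "x \<le> a")
    case False
    then show ?thesis
      using no_wave_above[of "c + 1" a x] c1A cA c bz ca a bz' mv v Mv that by auto
  qed (use c_last that in auto)
  have below: "?f x < M" if "-1 \<le> x" "x < a" for x
  proof (cases "z \<le> x")
    case False
    then show ?thesis
      using no_wave_below[of a x c] aA a1A a za bz bz' v Mv mv c ca that by auto
  qed (use a_first that in auto)
  have "z + l \<in> ?T" if "2 * (c + 1) \<le> z + l"
  proof -
    have "(c + 1) + (z + l - (c + 1)) \<in> ?T"
      using that c bz above by (intro excess_window) auto
    then show ?thesis by simp
  qed
  moreover have "z' \<in> ?T" if "z' \<le> 2 * a"
  proof -
    have "(z' - a) + a \<in> ?T"
      using that a bz' below by (intro excess_window) auto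
    then show ?thesis by simp
  qed
  \<comment> \<open>As \<open>c + 1 <= a\<close>, these give \<open>z + l < z'\<close>, although
    \<open>z'\<close> is below \<open>l\<close>.\<close>
  ultimately have "z + l < 2 * (c + 1)" "2 * a < z'" using bz(5) bz'(4) not_le by blast+
  moreover have "c + 1 \<le> a" using ca by simp
  ultimately show False using bz(1) bz'(2) by (smt (verit))
qed

end

lemma normal_small_doubling_dense:
  "normal_small_doubling A l \<Longrightarrow> l \<le> 2 * int (card A) - 4"
proof (induction "card A" arbitrary: A l rule: less_induct)
  case less
  show ?case
  proof (rule ccontr)
    assume "\<not> ?thesis"
    then interpret minimal_sparse A l using less by unfold_locales auto
    show False by (rule contradiction)
  qed
qed

section \<open>Rectified sets of residues\<close>

text \<open>Translation and division by the gcd of the differences lead to a normal form, where the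
  density bound opens the way to \<open>long_interval\<close>.\<close>

lemma freiman_normal_form:
  fixes A :: "int set"
  assumes "finite A" "card (A + A) + 4 \<le> 3 * card A"
  obtains a d B l where "0 < d" "A = (\<lambda>b. a + d * b) ` B" "dense_pair B B l"
    "card B = card A" "card (B + B) = card (A + A)" "1 \<le> l" "l \<le> 2 * int (card A) - 4"
proof -
  have ne: "A \<noteq> {}" using assms by auto
  have "3 \<le> card A" using card_sumset_ge_trivial[of A A] assms ne by linarith
  define a where "a = Min A"
  define V where "V = (\<lambda>x. x - a) ` A"
  define d where "d = Gcd V"
  have a: "a \<in> A" "\<And>x. x \<in> A \<Longrightarrow> a \<le> x" using assms(1) ne by (auto simp: a_def)
  have cV: "card V = card A" unfolding V_def by (simp add: card_image)
  have V0: "0 \<in> V" "\<And>v. v \<in> V \<Longrightarrow> 0 \<le> v" using a by (auto simp: V_def)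
  have "\<not> V \<subseteq> {0}"
    using card_mono[of "{0::int}" V] cV \<open>3 \<le> card A\<close> by auto
  then have d0: "0 < d" using Gcd_0_iff[of V] by (simp add: d_def order_less_le)
  define B where "B = (\<lambda>v. v div d) ` V"
  have VB: "V = (\<lambda>b. d * b) ` B"
    by (force simp: B_def image_image d_def Gcd_dvd intro!: image_eqI)
  have inj: "inj_on (\<lambda>b. d * b) S" for S using d0 by (simp add: inj_on_def)
  have AB: "A = (\<lambda>b. a + d * b) ` B"
  proof -
    have "A = (\<lambda>v. a + v) ` V" by (simp add: V_def image_image)
    then show ?thesis by (simp add: VB image_image)
  qed
  have cB: "card B = card A" using cV VB card_image[OF inj] by simp
  have "A + A = (\<lambda>b. (a + a) + d * b) ` (B + B)"
  proof -
    have "\<exists>s. (\<exists>x\<in>B. \<exists>y\<in>B. s = x + y) \<and> (a + d * x) + (a + d * y) = (a + a) + d * s"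
      if "x \<in> B" "y \<in> B" for x y
      using that by (intro exI[of _ "x + y"]) (auto simp: algebra_simps)
    moreover have "\<exists>x'\<in>B. \<exists>y'\<in>B. (a + a) + d * (x + y) = (a + d * x') + (a + d * y')"
      if "x \<in> B" "y \<in> B" for x y
      using that by (intro bexI[of _ x] bexI[of _ y]) (auto simp: algebra_simps)
    ultimately show ?thesis unfolding AB by (fastforce simp: set_plus_def image_iff)
  qed
  then have cBB: "card (B + B) = card (A + A)"
    using d0 by (simp add: card_image inj_on_def)
  have "finite B" using assms(1) by (simp add: B_def V_def)
  define l where "l = Max B"
  have B0: "0 \<in> B" using V0 by (force simp: B_def)
  have Bl: "B \<subseteq> {0..l}" "l \<in> B"
  proof -
    show "l \<in> B" unfolding l_def using \<open>finite B\<close> B0 by (intro Max_in) auto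
    have "0 \<le> b" if "b \<in> B" for b
      using that V0 d0 by (auto simp: B_def pos_imp_zdiv_nonneg_iff)
    then show "B \<subseteq> {0..l}" unfolding l_def using \<open>finite B\<close> by auto
  qed
  have "Gcd V = normalize (d * Gcd B)" unfolding VB by (rule Gcd_mult)
  then have "d * Gcd B = d" using d0 by (simp add: d_def[symmetric] abs_mult)
  then have "Gcd B = 1" using d0 by simp
  then have "normal_small_doubling B l"
    using Bl B0 cB cBB assms by (simp add: normal_small_doubling_def)
  then have lB: "l \<le> 2 * int (card B) - 4" by (rule normal_small_doubling_dense)
  have "B \<noteq> {0}" using cB \<open>3 \<le> card A\<close> by auto
  then have "1 \<le> l" using Bl B0 by (cases "l = 0") force+
  moreover have "dense_pair B B l" using Bl B0 lB by unfold_locales auto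
  ultimately show ?thesis using that[OF d0 AB _ cB cBB] lB cB by simp
qed

section \<open>Affine maps modulo p\<close>

lemma inj_on_affine_mod:
  fixes u w :: int
  assumes "coprime u (int p)"
  shows "inj_on (\<lambda>x. (u * int x + w) mod int p) {0..<p}"
proof (rule inj_onI)
  fix x y assume *: "x \<in> {0..<p}" "y \<in> {0..<p}" "(u * int x + w) mod int p = (u * int y + w) mod int p"
  then have "int p dvd u * (int x - int y)"
    by (simp add: mod_eq_dvd_iff algebra_simps)
  then have "int p dvd int x - int y"
    using assms by (simp add: coprime_commute coprime_dvd_mult_right_iff)
  then have "int x mod int p = int y mod int p" by (simp add: mod_eq_dvd_iff)
  then show "x = y" using * by simp
qed

lemma inj_on_mod_interval:
  fixes a b q :: int
  assumes "b - a < q"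
  shows "inj_on (\<lambda>x. x mod q) {a..b}"
proof (rule inj_onI)
  fix x y assume *: "x \<in> {a..b}" "y \<in> {a..b}" "x mod q = y mod q"
  then have "q dvd x - y" by (simp add: mod_eq_dvd_iff)
  moreover have "\<bar>x - y\<bar> < q" using * assms by auto
  ultimately show "x = y" using zdvd_not_zless[of "\<bar>x - y\<bar>" q] by fastforce
qed

lemma coprime_prime_if_between:
  assumes "prime p" "0 < d" "d < int p"
  shows "coprime d (int p)"
  using assms by (metis coprime_commute prime_imp_coprime prime_nat_int_transfer zdvd_not_zless)

lemma image_sumset_mod:
  assumes "A \<subseteq> {0..<p}"
  shows "(\<lambda>s. (u * int s + 2 * w) mod int p) ` sumset_mod p A =
    (\<lambda>t. t mod int p) ` ((\<lambda>x. (u * int x + w) mod int p) ` A + (\<lambda>x. (u * int x + w) mod int p) ` A)"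
    (is "?L = ?R")
proof -
  define f where "f x = (u * int x + w) mod int p" for x
  have *: "(u * int ((x + y) mod p) + 2 * w) mod int p = (f x + f y) mod int p" for x y
  proof -
    have "(u * int ((x + y) mod p) + 2 * w) mod int p = (u * (int x + int y) + 2 * w) mod int p"
      unfolding zmod_int of_nat_add by (metis mod_add_left_eq mod_mult_right_eq)
    also have "u * (int x + int y) + 2 * w = (u * int x + w) + (u * int y + w)"
      by (simp add: algebra_simps)
    finally show ?thesis unfolding f_def by (simp add: mod_add_eq)
  qed
  have "?L = (\<lambda>(x, y). (f x + f y) mod int p) ` (A \<times> A)"
    unfolding sumset_mod_def using * by (force simp: image_iff)
  also have "\<dots> = (\<lambda>t. t mod int p) ` (f ` A + f ` A)"
    by (force simp: image_iff set_plus_def)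
  finally show ?thesis by (simp add: f_def)
qed

lemma sumset_mod_subset: "0 < p \<Longrightarrow> sumset_mod p A \<subseteq> {0..<p}"
  by (auto simp: sumset_mod_def)

lemma sumset_mod_mono: "A \<subseteq> B \<Longrightarrow> sumset_mod p A \<subseteq> sumset_mod p B"
  by (auto simp: sumset_mod_def)

text \<open>Two numbers from \<open>{0..h}\<close> add up to less than \<open>p\<close>, so
  reduction changes nothing and the integers copy the sumset faithfully.\<close>

lemma rectified_sumset:
  fixes u w h :: int
  assumes A: "A \<subseteq> {0..<p}" and u: "coprime u (int p)"
    and X: "X = (\<lambda>x. (u * int x + w) mod int p) ` A" "X \<subseteq> {0..h}" "2 * h < int p" "A \<noteq> {}"
  shows "X + X = (\<lambda>s. (u * int s + 2 * w) mod int p) ` sumset_mod p A"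
    and "card (X + X) = card (sumset_mod p A)" and "card X = card A"
    and "finite X"
proof -
  have p0: "0 < p" using A X by auto
  have "(\<lambda>t. t mod int p) ` (X + X) = (\<lambda>t. t) ` (X + X)"
  proof (rule image_cong)
    fix t assume "t \<in> X + X"
    then obtain x y where "t = x + y" "x \<in> X" "y \<in> X" by (elim set_plus_elim)
    moreover have "0 \<le> x" "x \<le> h" "0 \<le> y" "y \<le> h" using calculation X by auto
    ultimately show "t mod int p = t" using X by simp
  qed simp
  then show XX: "X + X = (\<lambda>s. (u * int s + 2 * w) mod int p) ` sumset_mod p A"
    using image_sumset_mod[OF A, of u w] X by simp
  show "card (X + X) = card (sumset_mod p A)"
    unfolding XX using inj_on_subset[OF inj_on_affine_mod[OF u] sumset_mod_subset[OF p0]]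
    by (rule card_image)
  show "card X = card A"
    unfolding X using inj_on_subset[OF inj_on_affine_mod[OF u] A] by (rule card_image)
  show "finite X" using X finite_subset by blast
qed

lemma obtain_inverse_mod:
  assumes "coprime u (int p)"
  obtains v where "(v * u) mod int p = 1 mod int p" "coprime v (int p)"
proof -
  obtain v t where vt: "v * u + t * int p = 1"
    using bezout_int[of u "int p"] assms by auto
  have "(v * u) mod int p = (v * u + t * int p) mod int p" by simp
  also have "\<dots> = 1 mod int p" by (simp only: vt)
  finally have "(v * u) mod int p = 1 mod int p" .
  moreover have "coprime v (int p)"
  proof (rule coprimeI)
    fix c assume "c dvd v" "c dvd int p"
    then have "c dvd v * u + t * int p" by simp
    then show "is_unit c" by (simp only: vt)
  qed
  ultimately show ?thesis using that by blast
qed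

lemma affine_mod_cancel:
  fixes u v w y q :: int
  assumes "(v * u) mod q = 1 mod q" "(u * x + w) mod q = y mod q"
  shows "x mod q = (v * (y - w)) mod q"
proof -
  have "q dvd v * ((u * x + w) - y)" using assms(2) by (simp add: mod_eq_dvd_iff)
  moreover have "q dvd (v * u - 1) * x" using assms(1) by (simp add: mod_eq_dvd_iff)
  ultimately have "q dvd v * ((u * x + w) - y) - (v * u - 1) * x" by (rule dvd_diff)
  then have "q dvd x - v * (y - w)" by (simp add: algebra_simps)
  then show ?thesis by (simp add: mod_eq_dvd_iff)
qed

lemma mod_affine_simp: "(x mod q + i * (y mod q)) mod q = (x + i * y) mod (q :: int)"
  by (metis mod_add_cong mod_mod_trivial mod_mult_right_eq)

lemma ap_mod_eq_int:
  "int ` ap_mod p a g k = (\<lambda>i. (int a + int i * int g) mod int p) ` {..<k}"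
proof -
  have "ap_mod p a g k = (\<lambda>i. (a + i * g) mod p) ` {..<k}" by (auto simp: ap_mod_def)
  then show ?thesis by (simp add: image_image zmod_int)
qed

lemma card_ap_mod:
  assumes "coprime (int g) (int p)" "k \<le> p"
  shows "card (ap_mod p a g k) = k"
proof -
  have "inj_on (\<lambda>x. (int g * int x + int a) mod int p) {..<k}"
    using assms(2) by (intro inj_on_subset[OF inj_on_affine_mod[OF assms(1)]]) auto
  then have "card ((\<lambda>i. (int a + int i * int g) mod int p) ` {..<k}) = k"
    by (subst card_image) (simp_all add: algebra_simps)
  then have "card (int ` ap_mod p a g k) = k" by (simp add: ap_mod_eq_int)
  then show ?thesis by (simp add: card_image)
qed

text \<open>Freiman's theorem is applied to the integer copy \<open>X\<close>, and progressions are
  carried back by the inverse \<open>v\<close> of \<open>u\<close>, which gives both the difference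
  \<open>v * d\<close>. The cover has \<open>l + 1\<close> terms, and \<open>card_sumset_ge\<close>
  bounds \<open>l\<close> by |2A| - |A|.\<close>

lemma conclusion_if_rectified:
  fixes u w h :: int
  assumes p: "prime p" and A: "A \<subseteq> {0..<p}" and u: "coprime u (int p)"
    and X: "(\<lambda>x. (u * int x + w) mod int p) ` A \<subseteq> {0..h}" "2 * h < int p"
    and small: "card (sumset_mod p A) + 4 \<le> 3 * card A"
  shows "\<exists>g PA P2A. is_ap_diff p g PA \<and> is_ap_diff p g P2A \<and> A \<subseteq> PA \<and>
           int (card PA) \<le> int (card A) + (int (card (sumset_mod p A)) - 2 * int (card A)) + 1 \<and>
           P2A \<subseteq> sumset_mod p A \<and> int (card P2A) \<ge> 2 * int (card A) - 1"
proof -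
  define X where "X = (\<lambda>x. (u * int x + w) mod int p) ` A"
  have ne: "A \<noteq> {}" using small by auto
  have p0: "0 < p" using p prime_gt_0_nat by blast
  note R = rectified_sumset[OF A u X_def X(1)[folded X_def] X(2) ne]
  have "finite X" "card (X + X) + 4 \<le> 3 * card X" using R small by simp_all
  then obtain a d B l where nf: "0 < d" "X = (\<lambda>b. a + d * b) ` B" "dense_pair B B l"
    "card B = card X" "card (B + B) = card (X + X)" "1 \<le> l" "l \<le> 2 * int (card X) - 4"
    using freiman_normal_form by metis
  interpret dense_pair B B l by (rule nf(3))
  let ?n = "card A" and ?S = "sumset_mod p A"
  have Scard: "card ?S \<le> p" using card_mono[OF _ sumset_mod_subset[OF p0, of A]] by simp
  have lS: "l + int ?n \<le> int (card ?S)" using card_sumset_ge nf R by simp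
  obtain e where e: "{e..e + int ?n + int ?n - 2} \<subseteq> B + B"
    using long_interval nf R small by auto
  obtain v where v: "(v * u) mod int p = 1 mod int p" "coprime v (int p)"
    using obtain_inverse_mod[OF u] .
  have XS: "X \<subseteq> {0..h}" using X X_def by simp
  \<comment> \<open>These two points of \<open>X\<close> bound \<open>d\<close> by
    \<open>h < p\<close>, which makes \<open>d\<close> invertible modulo \<open>p\<close>.\<close>
  have "a + d * 0 \<in> X" "a + d * l \<in> X" unfolding nf(2) using ends by (blast intro: imageI)+
  then have "0 \<le> a" "a + d * l \<le> h" using XS by auto
  then have "d * l \<le> h" "0 \<le> h" using nf(1,6) by (simp, smt (verit) mult_pos_pos)
  moreover have "d * 1 \<le> d * l" using nf by (intro mult_left_mono) auto
  ultimately have dp: "d < int p" using X by simp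
  have cop: "coprime (v * d) (int p)"
    using v coprime_prime_if_between[OF p nf(1) dp] by simp
  define g where "g = nat ((v * d) mod int p)"
  have g: "int g = (v * d) mod int p" using p0 by (simp add: g_def)
  have gcop: "coprime (int g) (int p)" using cop p0 by (simp add: g coprime_mod_left_iff)
  have gp: "g < p" using g p0 by (metis of_nat_0_less_iff of_nat_less_iff pos_mod_bound)
  have g0: "g mod p \<noteq> 0" using gcop gp p by (cases "g = 0") (auto dest: prime_gt_1_nat)
  define r where "r c = nat (v * (c - w) mod int p)" for c
  have r: "int (r c) = v * (c - w) mod int p" "r c < p" for c
    using p0 by (simp_all add: r_def nat_less_iff)
  define PA where "PA = ap_mod p (r a) g (nat l + 1)"
  \<comment> \<open>The start \<open>e\<close> of the interval in \<open>B + B\<close> corresponds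
    to \<open>2 * a + d * e\<close> in \<open>X + X\<close>; sums are shifted by
    \<open>2 * w\<close>.\<close>
  define r2 where "r2 = nat (v * (2 * a + d * e - 2 * w) mod int p)"
  have r2: "int r2 = v * (2 * a + d * e - 2 * w) mod int p" "r2 < p"
    using p0 by (simp_all add: r2_def nat_less_iff)
  define P2A where "P2A = ap_mod p r2 g (2 * card A - 1)"
  have n1: "1 \<le> ?n" using small by simp
  have n2: "2 * ?n - 1 \<le> p"
    using card_sumset_ge_trivial[of X X] R ne X_def Scard by simp
  have d1: "is_ap_diff p g PA"
    unfolding is_ap_diff_def PA_def using g0 r(2)[of a] lS n1 Scard nf(6)
    by (intro conjI exI[of _ "r a"] exI[of _ "nat l + 1"]) auto
  have d2: "is_ap_diff p g P2A"
    unfolding is_ap_diff_def P2A_def using g0 r2(2) n1 n2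
    by (intro conjI exI[of _ r2] exI[of _ "2 * ?n - 1"]) auto
  have "A \<subseteq> PA"
  proof
    fix x assume x: "x \<in> A"
    then have "(u * int x + w) mod int p \<in> X" by (simp add: X_def)
    then obtain b where b: "b \<in> B" "(u * int x + w) mod int p = a + d * b" using nf(2) by auto
    then have b0: "0 \<le> b" "b \<le> l" using subs by auto
    have "(u * int x + w) mod int p = (a + d * b) mod int p" using b(2) by (metis mod_mod_trivial)
    then have "int x mod int p = (v * (a + d * b - w)) mod int p" by (rule affine_mod_cancel[OF v(1)])
    also have "v * (a + d * b - w) = v * (a - w) + b * (v * d)" by (simp add: algebra_simps)
    also have "\<dots> mod int p = (int (r a) + int (nat b) * int g) mod int p"
      using b0 by (simp add: r g mod_affine_simp)
    finally have "int x \<in> int ` PA"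
      unfolding PA_def ap_mod_eq_int using b0 x A by (intro image_eqI[of _ _ "nat b"]) auto
    then show "x \<in> PA" by auto
  qed
  moreover have "card PA \<le> nat l + 1"
    unfolding PA_def ap_mod_def using card_image_le[of "{..<nat l + 1}" "\<lambda>i. (r a + i * g) mod p"]
    by (simp add: image_def Bex_def conj_commute lessThan_def)
  moreover have "P2A \<subseteq> ?S"
  proof
    fix y assume "y \<in> P2A"
    then obtain i where i: "i < 2 * ?n - 1" "y = (r2 + i * g) mod p" by (auto simp: P2A_def ap_mod_def)
    then have "e + int i \<in> B + B" using e by auto
    then obtain b c where bc: "b \<in> B" "c \<in> B" "e + int i = b + c" by (elim set_plus_elim)
    then have "(a + d * b) + (a + d * c) \<in> X + X" unfolding nf(2) by (intro set_plus_intro) auto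
    also have "(a + d * b) + (a + d * c) = 2 * a + d * (e + int i)" by (simp add: bc(3) algebra_simps)
    finally obtain s where s: "s \<in> ?S" "(u * int s + 2 * w) mod int p = 2 * a + d * (e + int i)"
      unfolding R(1) by auto
    then have "(u * int s + 2 * w) mod int p = (2 * a + d * (e + int i)) mod int p"
      by (metis mod_mod_trivial)
    then have "int s mod int p = (v * (2 * a + d * (e + int i) - 2 * w)) mod int p"
      by (rule affine_mod_cancel[OF v(1)])
    also have "v * (2 * a + d * (e + int i) - 2 * w) = v * (2 * a + d * e - 2 * w) + int i * (v * d)"
      by (simp add: algebra_simps)
    also have "\<dots> mod int p = (int r2 + int i * int g) mod int p" by (simp only: r2 g mod_affine_simp)
    also have "\<dots> = int y" using i(2) by (simp add: zmod_int)
    finally have "s = y" using s(1) sumset_mod_subset[OF p0, of A] by fastforce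
    then show "y \<in> ?S" using s by simp
  qed
  moreover have "card P2A = 2 * ?n - 1"
    unfolding P2A_def by (rule card_ap_mod[OF gcop n2])
  ultimately show ?thesis
    using d1 d2 lS nf(6) by (intro exI[of _ g] exI[of _ PA] exI[of _ P2A]) auto
qed

text \<open>\<open>dense_pair\<close> asks the second set to reach the common right end, so the
  longer set is put second; the conditions cover either order.\<close>

lemma long_interval_any_order:
  fixes A B :: "int set"
  assumes A: "A \<subseteq> {0..l}" "0 \<in> A" "l \<in> A" and B: "B \<subseteq> {0..m}" "0 \<in> B" "m \<in> B"
    and "l + 3 \<le> int (card A) + int (card B)" "m + 3 \<le> int (card A) + int (card B)"
    and "card (A + B) + 4 \<le> 2 * card A + card B" "card (A + B) + 4 \<le> card A + 2 * card B"
  shows "\<exists>a. {a..a + int (card A) + int (card B) - 2} \<subseteq> A + B"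
proof (cases "l \<le> m")
  case True
  then interpret dense_pair A B m using assms by unfold_locales auto
  show ?thesis using long_interval assms by simp
next
  case False
  then interpret dense_pair B A l using assms by unfold_locales auto
  show ?thesis using long_interval assms by (simp add: add.commute add.left_commute)
qed

text \<open>\<open>A - A'\<close> may lie anywhere, but \<open>C - A'\<close> misses \<open>A\<close>, where \<open>C\<close> is the complement of the sumset.
  As \<open>A' + A'\<close> contains a long progression, \<open>C\<close> fits into an interval short enough to treat
  \<open>C - A'\<close> as a sumset of integers, which again contains a long interval.\<close>

lemma rectify_superset:
  fixes u w :: int and h :: int
  assumes h_def: "h = (int p - 1) div 2"
    and p: "prime p" and A: "A \<subseteq> {0..<p}" and A': "A' \<subseteq> A" and u: "coprime u (int p)"
    and X: "(\<lambda>x. (u * int x + w) mod int p) ` A' \<subseteq> {0..h}"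
    and large: "card (sumset_mod p A) + 4 \<le> 3 * card A'"
    and sparse: "4 * card (sumset_mod p A) \<le> 3 * p"
  shows "\<exists>u w. coprime u (int p) \<and> (\<lambda>x. (u * int x + w) mod int p) ` A \<subseteq> {0..h}"
proof (cases "A' = A")
  case True
  then show ?thesis using u X by blast
next
  case False
  define S where "S = sumset_mod p A"
  define X where "X = (\<lambda>x. (u * int x + w) mod int p) ` A'"
  have p0: "0 < p" using p prime_gt_0_nat by blast
  have hp: "2 * h < int p" by (simp add: h_def)
  have finA: "finite A" using A finite_subset by blast
  have ltA: "card A' < card A" using A' False finA by (simp add: psubset_card_mono psubsetI)
  have A'p: "A' \<subseteq> {0..<p}" and ne: "A' \<noteq> {}" using A A' large by auto
  have XS: "X \<subseteq> {0..h}" using X by (simp add: X_def)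
  note R = rectified_sumset[OF A'p u X_def XS hp ne]
  have Sp: "S \<subseteq> {0..<p}" unfolding S_def by (rule sumset_mod_subset[OF p0])
  then have finS: "finite S" using finite_subset by blast
  have cXX: "card (X + X) \<le> card S"
    unfolding R(2) S_def using finS[unfolded S_def] sumset_mod_mono[OF A'] by (rule card_mono)
  have "card (X + X) + 4 \<le> 3 * card X" using cXX R large by (simp add: S_def)
  then obtain a d B l where nf: "0 < d" "X = (\<lambda>b. a + d * b) ` B" "dense_pair B B l"
    "card B = card X" "card (B + B) = card (X + X)" "1 \<le> l" "l \<le> 2 * int (card X) - 4"
    using freiman_normal_form[OF R(4)] by metis
  interpret B: dense_pair B B l by (rule nf(3))
  let ?n = "card A'"
  have cB: "card B = ?n" using nf R by simp
  have BBsmall: "card (B + B) + 4 \<le> 3 * card B" using nf R large cXX by (simp add: S_def)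
  have lS: "l + int ?n \<le> int (card S)" using B.card_sumset_ge nf R cXX by simp
  have "\<exists>e. {e..e + int (card B) + int (card B) - 2} \<subseteq> B + B"
    using BBsmall by (intro B.long_interval) simp
  then obtain e where "{e..e + int (card B) + int (card B) - 2} \<subseteq> B + B" by blast
  then have e: "{e..e + 2 * int ?n - 2} \<subseteq> B + B" by (simp only: cB mult_2 add.assoc)
  have "a + d * 0 \<in> X" "a + d * l \<in> X" unfolding nf(2) using B.ends by (blast intro: imageI)+
  then have "0 \<le> a" "a + d * l \<le> h" using XS by auto
  then have dl: "d * l \<le> h" by simp
  have "d * 1 \<le> d * l" "1 * l \<le> d * l" using nf by (intro mult_mono; simp)+
  then have "d \<le> h" and lh: "l \<le> h" using dl by linarith+
  then have dp: "d < int p" using hp nf(1) by linarith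
  obtain v where v: "(v * d) mod int p = 1 mod int p" "coprime v (int p)"
    using obtain_inverse_mod[OF coprime_prime_if_between[OF p nf(1) dp]] .

  \<comment> \<open>Dilating by the inverse of \<open>d\<close> makes the progression in the sumset
    an interval: the new map \<open>f\<close> carries \<open>A'\<close> to \<open>B\<close>, and 2A
    to \<open>S1\<close>.\<close>
  define u1 where "u1 = v * u"
  define w1 where "w1 = v * (w - a)"
  have u1: "coprime u1 (int p)" using u v by (simp add: u1_def)
  define f where "f x = (u1 * int x + w1) mod int p" for x
  define S1 where "S1 = (\<lambda>s. (u1 * int s + 2 * w1) mod int p) ` S"
  have cS1: "card S1 = card S"
    unfolding S1_def by (rule card_image[OF inj_on_subset[OF inj_on_affine_mod[OF u1] Sp]])
  have S1p: "S1 \<subseteq> {0..<int p}" using p0 by (auto simp: S1_def)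
  have fS1: "(f x + f y) mod int p \<in> S1" if "x \<in> A" "y \<in> A" for x y
  proof -
    have "(f x + f y) mod int p \<in> (\<lambda>t. t mod int p) ` (f ` A + f ` A)"
      using that by (intro imageI set_plus_intro)
    then show ?thesis
      using image_sumset_mod[OF A, of u1 w1] unfolding f_def S1_def S_def by simp
  qed
  have Bf: "B \<subseteq> f ` A"
  proof
    fix b assume b: "b \<in> B"
    then have "a + d * b \<in> X" using nf(2) by blast
    then obtain x where x: "x \<in> A'" "a + d * b = (u * int x + w) mod int p" by (auto simp: X_def)
    have "(d * b + (a - w)) mod int p = (u * int x) mod int p"
      using x(2) by (simp add: mod_eq_dvd_iff mod_simps algebra_simps)
    then have "b mod int p = (v * (u * int x - (a - w))) mod int p" by (rule affine_mod_cancel[OF v(1)])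
    also have "v * (u * int x - (a - w)) = u1 * int x + w1" by (simp add: u1_def w1_def algebra_simps)
    finally have "b mod int p = f x" by (simp add: f_def)
    moreover have "b mod int p = b" using b B.subs lh hp by auto
    ultimately show "b \<in> f ` A" using x A' by auto
  qed
  have BBS1: "w \<in> S1" if w: "w \<in> B + B" for w
  proof -
    obtain b c where bc: "w = b + c" "b \<in> B" "c \<in> B" using w by (rule set_plus_elim)
    then obtain x y where "x \<in> A" "y \<in> A" "b = f x" "c = f y" using Bf by blast
    then have "(b + c) mod int p \<in> S1" using fS1 by simp
    moreover have "0 \<le> b" "0 \<le> c" "b \<le> l" "c \<le> l" using bc B.subs by auto
    ultimately show ?thesis using lh hp bc by simp
  qed

  \<comment> \<open>The first 2|A'| - 1 places of the period from \<open>e\<close> to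
    \<open>e + p - 1\<close> are sums from \<open>B + B\<close>, so all residues outside
    \<open>S1\<close> have their representatives here.\<close>
  define C where "C = {e + 2 * int ?n - 1..e + int p - 1} \<inter> {y. y mod int p \<notin> S1}"
  define c where "c = p - card S"
  have Scard: "card S < p" using sparse p0 by (simp add: S_def)
  have cC: "card C = c"
  proof -
    let ?W = "{e..e + int p - 1}"
    have injW: "inj_on (\<lambda>y. y mod int p) ?W" by (rule inj_on_mod_interval) simp
    have "(\<lambda>y. y mod int p) ` ?W = {0..<int p}"
    proof (rule card_subset_eq)
      show "(\<lambda>y. y mod int p) ` ?W \<subseteq> {0..<int p}" using p0 by auto
      show "card ((\<lambda>y. y mod int p) ` ?W) = card {0..<int p}" by (simp add: card_image[OF injW])
    qed simp
    moreover have CW: "C = ?W \<inter> {y. y mod int p \<notin> S1}"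
    proof -
      have "y mod int p \<in> S1" if y: "y \<in> ?W" "y < e + 2 * int ?n - 1" for y
      proof -
        have "y \<in> B + B" using y e by auto
        then have "y \<in> S1" by (rule BBS1)
        then show ?thesis using S1p by auto
      qed
      then show ?thesis using large by (force simp: C_def)
    qed
    ultimately have "(\<lambda>y. y mod int p) ` C = {0..<int p} - S1" by auto
    then have "card ((\<lambda>y. y mod int p) ` C) = p - card S"
      using S1p cS1 by (simp add: card_Diff_subset finite_subset)
    moreover have "inj_on (\<lambda>y. y mod int p) C" using injW CW by (auto intro: inj_on_subset)
    ultimately show ?thesis by (simp add: card_image c_def)
  qed
  have finC: "finite C" and neC: "C \<noteq> {}" using cC Scard by (auto simp: C_def c_def)
  define m where "m = Max C - Min C"
  define C1 where "C1 = (\<lambda>y. y + (- Min C)) ` C"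
  \<comment> \<open>Reflecting \<open>B\<close> makes the difference set \<open>C - B\<close> a
    sumset \<open>B1 + C1\<close>, up to the shift \<open>K\<close>.\<close>
  define B1 where "B1 = (\<lambda>b. l - b) ` B"
  have MC: "Max C \<in> C" "Min C \<in> C" using finC neC by auto
  have C1: "C1 \<subseteq> {0..m}" "0 \<in> C1" "m \<in> C1" "card C1 = c"
    using finC MC cC by (auto simp: C1_def m_def card_image)
  have B1: "B1 \<subseteq> {0..l}" "0 \<in> B1" "l \<in> B1" "card B1 = ?n"
    using B.subs B.ends cB by (auto simp: B1_def card_image inj_on_def)
  have mle: "m \<le> int p - 2 * int ?n" using MC by (auto simp: C_def m_def)
  define K where "K = Min C - l"
  have avoid: "(t + K) mod int p \<notin> f ` A" if t: "t \<in> B1 + C1" for t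
  proof
    assume "(t + K) mod int p \<in> f ` A"
    then obtain x where x: "x \<in> A" "(t + K) mod int p = f x" by auto
    from t obtain b y where by': "b \<in> B" "y \<in> C" "t = (l - b) + (y - Min C)"
      by (auto simp: B1_def C1_def elim!: set_plus_elim)
    then have y: "y = (t + K) + b" by (simp add: K_def)
    obtain x' where x': "x' \<in> A" "b = f x'" using Bf by' by blast
    have "y mod int p = (f x + f x') mod int p" unfolding y x(2)[symmetric] x'(2)[symmetric]
      by (simp add: mod_add_left_eq)
    then have "y mod int p \<in> S1" using fS1 x x' by simp
    then show False using by' by (simp add: C_def)
  qed
  have "card (B1 + C1) \<le> p - card A"
  proof -
    have "B1 + C1 \<subseteq> {0..l + m}"
    proof
      fix t assume "t \<in> B1 + C1"
      then obtain x y where "t = x + y" "x \<in> B1" "y \<in> C1" by (elim set_plus_elim)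
      moreover have "0 \<le> x" "x \<le> l" "0 \<le> y" "y \<le> m" using calculation B1 C1 by auto
      ultimately show "t \<in> {0..l + m}" by simp
    qed
    moreover have "inj_on (\<lambda>t. (t + K) mod int p) {0..l + m}"
    proof (rule inj_onI)
      fix s t assume st: "s \<in> {0..l + m}" "t \<in> {0..l + m}" "(s + K) mod int p = (t + K) mod int p"
      \<comment> \<open>The bounds l <= 2|A'| - 4 and m <= p - 2|A'| complement each other, so sums
        do not collide modulo \<open>p\<close>.\<close>
      have "l + m < int p" using nf(7) mle R(3) by simp
      then have "inj_on (\<lambda>x. x mod int p) {K..K + l + m}" by (intro inj_on_mod_interval) simp
      from inj_onD[OF this st(3)] show "s = t" using st by simp
    qed
    ultimately have inj: "inj_on (\<lambda>t. (t + K) mod int p) (B1 + C1)" using inj_on_subset by blast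
    have fA: "f ` A \<subseteq> {0..<int p}" "card (f ` A) = card A"
      using p0 card_image[OF inj_on_subset[OF inj_on_affine_mod[OF u1] A], of w1]
      by (auto simp: f_def)
    have "(\<lambda>t. (t + K) mod int p) ` (B1 + C1) \<subseteq> {0..<int p} - f ` A"
      using avoid p0 by auto
    then have "card ((\<lambda>t. (t + K) mod int p) ` (B1 + C1)) \<le> card ({0..<int p} - f ` A)"
      by (intro card_mono) auto
    then show ?thesis using fA finA by (simp add: card_image[OF inj] card_Diff_subset)
  qed
  moreover have "card A \<le> p" using card_mono[OF _ A] by simp
  ultimately have "card (B1 + C1) + card A \<le> p" by simp
  moreover have "card S + 4 \<le> 3 * ?n" "4 * card S \<le> 3 * p" using large sparse by (simp_all add: S_def)
  moreover have "int c = int p - int (card S)" using Scard by (simp add: c_def)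
  \<comment> \<open>The conditions reduce to |2A| + 3 <= 3|A'| and 2|2A| + 3 <= 2|A'| + p.
    \<open>large\<close> and \<open>sparse\<close> give the second only after rounding, and the last
    smallness condition reduces to it thanks to |A'| < |A|.\<close>
  ultimately have "\<exists>t. {t..t + int (card B1) + int (card C1) - 2} \<subseteq> B1 + C1"
    using ltA lS mle B1 C1 Scard by (intro long_interval_any_order[of B1 l C1 m]) auto
  then obtain t where t: "{t..t + int ?n + int c - 2} \<subseteq> B1 + C1" using B1 C1 by auto

  \<comment> \<open>\<open>J\<close> is the first place after the interval of |A'| + c - 1 residues
    that the image of \<open>A\<close> avoids; counted from \<open>J\<close>, that image lies in
    0..|2A| - |A'|.\<close>
  define J where "J = t + K + int ?n + int c - 1"
  have "(u1 * int x + (w1 - J)) mod int p \<in> {0..h}" if x: "x \<in> A" for x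
  proof -
    define r where "r = (f x - J) mod int p"
    have r: "0 \<le> r" "r < int p" using p0 by (simp_all add: r_def)
    have "r \<le> int (card S) - int ?n"
    proof (rule ccontr)
      assume "\<not> ?thesis"
      then have "t + (r - int p + int ?n + int c - 1) \<in> B1 + C1"
        using r Scard by (intro subsetD[OF t]) (auto simp: c_def)
      then have "(t + (r - int p + int ?n + int c - 1) + K) mod int p \<notin> f ` A" by (rule avoid)
      also have "t + (r - int p + int ?n + int c - 1) + K = r + J - int p" by (simp add: J_def)
      also have "(r + J - int p) mod int p = f x mod int p" by (simp add: r_def mod_simps)
      also have "f x mod int p = f x" by (simp add: f_def)
      finally show False using x by simp
    qed
    moreover have "2 * (int (card S) - int ?n) < int p" using large sparse by (simp add: S_def)
    ultimately have "r \<le> h" by (simp add: h_def)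
    moreover have "(u1 * int x + (w1 - J)) mod int p = r"
      by (simp add: r_def f_def mod_simps algebra_simps)
    ultimately show ?thesis using r by simp
  qed
  then show ?thesis using u1 by blast
qed

section \<open>Fourier coefficients of sets of residues\<close>

definition unity_root :: "nat \<Rightarrow> int \<Rightarrow> complex" where
  "unity_root p x = cis (2 * pi * of_int x / of_nat p)"

lemma unity_root_0 [simp]: "unity_root p 0 = 1"
  by (simp add: unity_root_def)

lemma unity_root_add: "unity_root p (x + y) = unity_root p x * unity_root p y"
  by (simp add: unity_root_def cis_mult add_divide_distrib distrib_left)

lemma cnj_unity_root: "cnj (unity_root p x) = unity_root p (- x)"
  by (simp add: unity_root_def cis_cnj)

lemma unity_root_mult_nat: "unity_root p (x * int n) = unity_root p x ^ n"
  by (induction n) (simp_all add: unity_root_add distrib_left)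

lemma unity_root_eq_1_iff:
  assumes "0 < p"
  shows "unity_root p x = 1 \<longleftrightarrow> int p dvd x"
proof
  assume "unity_root p x = 1"
  then have "cos (2 * pi * of_int x / of_nat p) = 1"
    by (metis unity_root_def cis.simps(1) one_complex.simps(1))
  then obtain n :: int where "2 * pi * of_int x / of_nat p = of_int n * 2 * pi"
    by (auto simp: cos_one_2pi_int)
  then have "real_of_int x = real_of_int (n * int p)" using assms by (simp add: field_simps)
  then show "int p dvd x" by (metis dvd_triv_right of_int_eq_iff)
next
  assume "int p dvd x"
  then obtain n where "x = int p * n" by (rule dvdE)
  then have "2 * pi * of_int x / of_nat p = of_int n * (2 * pi)" using assms by simp
  then show "unity_root p x = 1" unfolding unity_root_def by (metis cis_multiple_2pi Ints_of_int mult.commute)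
qed

lemma unity_root_cong:
  assumes "0 < p" "x mod int p = y mod int p"
  shows "unity_root p x = unity_root p y"
proof -
  have "unity_root p (x - y) = 1" using assms by (simp add: unity_root_eq_1_iff mod_eq_dvd_iff)
  then show ?thesis using unity_root_add[of p "x - y" y] by simp
qed

lemma sum_unity_root:
  assumes "0 < p"
  shows "(\<Sum>d<p. unity_root p (x * int d)) = (if int p dvd x then of_nat p else 0)"
proof (cases "int p dvd x")
  case True
  then have "unity_root p x = 1" using assms by (simp add: unity_root_eq_1_iff)
  then show ?thesis using True by (simp add: unity_root_mult_nat)
next
  case False
  then have "unity_root p x \<noteq> 1" using assms by (simp add: unity_root_eq_1_iff)
  moreover have "unity_root p x ^ p = 1"
    using assms unity_root_eq_1_iff[of p "x * int p"] by (simp add: unity_root_mult_nat)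
  ultimately show ?thesis using False by (simp add: unity_root_mult_nat sum_gp_strict)
qed

text \<open>Orthogonality of characters: summing over all frequencies detects divisibility, so
  moments of Fourier coefficients count solutions.\<close>

lemma sum_unity_root_count:
  assumes "0 < p" "finite I"
  shows "(\<Sum>d<p. \<Sum>i\<in>I. unity_root p (k i * int d)) = of_nat (p * card {i \<in> I. int p dvd k i})"
proof -
  have "(\<Sum>d<p. \<Sum>i\<in>I. unity_root p (k i * int d)) = (\<Sum>i\<in>I. if int p dvd k i then of_nat p else 0)"
    by (subst sum.swap) (simp add: sum_unity_root[OF assms(1)])
  also have "\<dots> = (\<Sum>i\<in>{i \<in> I. int p dvd k i}. of_nat p)"
    using assms(2) by (intro sum.inter_filter[symmetric])
  finally show ?thesis by simp
qed

definition fourier :: "nat \<Rightarrow> nat set \<Rightarrow> nat \<Rightarrow> complex" where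
  "fourier p X d = (\<Sum>x\<in>X. unity_root p (int x * int d))"

lemma fourier_0 [simp]: "fourier p X 0 = of_nat (card X)"
  by (simp add: fourier_def)

lemma nat_eq_if_dvd_diff:
  assumes "x < p" "y < p" "int p dvd int x - int y"
  shows "x = y"
proof -
  have "int x mod int p = int y mod int p" using assms(3) by (simp only: mod_eq_dvd_iff)
  then have "x mod p = y mod p" by (simp only: zmod_int[symmetric] of_nat_eq_iff)
  then show ?thesis using assms by (metis mod_less)
qed

lemma parseval:
  assumes "0 < p" "X \<subseteq> {0..<p}"
  shows "(\<Sum>d<p. (norm (fourier p X d))\<^sup>2) = real (p * card X)"
proof -
  have fin: "finite X" using assms(2) finite_subset by blast
  have "complex_of_real ((norm (fourier p X d))\<^sup>2) =
      (\<Sum>(x, y)\<in>X \<times> X. unity_root p ((int x - int y) * int d))" for d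
  proof -
    have "complex_of_real ((norm (fourier p X d))\<^sup>2) = fourier p X d * cnj (fourier p X d)"
      by (rule complex_norm_square)
    also have "\<dots> = (\<Sum>(x, y)\<in>X \<times> X. unity_root p (int x * int d) * unity_root p (- (int y * int d)))"
      by (simp add: fourier_def cnj_unity_root sum_product sum.cartesian_product)
    finally show ?thesis by (simp add: unity_root_add[symmetric] left_diff_distrib)
  qed
  then have "complex_of_real (\<Sum>d<p. (norm (fourier p X d))\<^sup>2) =
      (\<Sum>d<p. \<Sum>i\<in>X \<times> X. unity_root p ((int (fst i) - int (snd i)) * int d))"
    by (simp add: case_prod_beta)
  also have "\<dots> = of_nat (p * card {i \<in> X \<times> X. int p dvd int (fst i) - int (snd i)})"
    using assms fin by (intro sum_unity_root_count) auto
  also have "{i \<in> X \<times> X. int p dvd int (fst i) - int (snd i)} = (\<lambda>x. (x, x)) ` X"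
  proof
    show "{i \<in> X \<times> X. int p dvd int (fst i) - int (snd i)} \<subseteq> (\<lambda>x. (x, x)) ` X"
    proof
      fix i assume i: "i \<in> {i \<in> X \<times> X. int p dvd int (fst i) - int (snd i)}"
      then have "fst i < p" "snd i < p" using assms(2) by auto
      then have "fst i = snd i" using i by (intro nat_eq_if_dvd_diff) auto
      then show "i \<in> (\<lambda>x. (x, x)) ` X" using i by (cases i) auto
    qed
  qed auto
  also have "card ((\<lambda>x. (x, x)) ` X) = card X" by (simp add: card_image inj_on_def)
  finally show ?thesis by (metis of_real_eq_iff of_real_of_nat_eq)
qed

text \<open>By orthogonality the sum is p times the number of solutions of x + y = s, and each of
  the |A|^2 pairs has exactly one \<open>s\<close>.\<close>

lemma fourier_sumset:
  assumes "0 < p" "A \<subseteq> {0..<p}"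
  shows "(\<Sum>d<p. (fourier p A d)\<^sup>2 * cnj (fourier p (sumset_mod p A) d)) = of_nat (p * (card A)\<^sup>2)"
proof -
  let ?S = "sumset_mod p A"
  have fin: "finite A" using assms(2) finite_subset by blast
  have Sp: "?S \<subseteq> {0..<p}" using assms by (auto simp: sumset_mod_def)
  then have finS: "finite ?S" using finite_subset by blast
  have "(fourier p A d)\<^sup>2 * cnj (fourier p ?S d) =
      (\<Sum>i\<in>(A \<times> A) \<times> ?S. unity_root p ((int (fst (fst i)) + int (snd (fst i)) - int (snd i)) * int d))" for d
  proof -
    have "(fourier p A d)\<^sup>2 * cnj (fourier p ?S d) = (\<Sum>i\<in>(A \<times> A) \<times> ?S.
        unity_root p (int (fst (fst i)) * int d) * unity_root p (int (snd (fst i)) * int d) *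
        unity_root p (- (int (snd i) * int d)))"
      by (simp add: fourier_def cnj_unity_root sum_product sum.cartesian_product power2_eq_square case_prod_beta)
    then show ?thesis by (simp add: unity_root_add[symmetric] algebra_simps)
  qed
  then have "(\<Sum>d<p. (fourier p A d)\<^sup>2 * cnj (fourier p ?S d)) = (\<Sum>d<p. \<Sum>i\<in>(A \<times> A) \<times> ?S.
      unity_root p ((int (fst (fst i)) + int (snd (fst i)) - int (snd i)) * int d))"
    by simp
  also have "\<dots> = of_nat (p * card {i \<in> (A \<times> A) \<times> ?S. int p dvd int (fst (fst i)) + int (snd (fst i)) - int (snd i)})"
    using assms fin finS by (intro sum_unity_root_count) auto
  also have "{i \<in> (A \<times> A) \<times> ?S. int p dvd int (fst (fst i)) + int (snd (fst i)) - int (snd i)} =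
      (\<lambda>(a, b). ((a, b), (a + b) mod p)) ` (A \<times> A)" (is "?L = ?R")
  proof
    show "?L \<subseteq> ?R"
    proof
      fix i assume i: "i \<in> ?L"
      obtain a b s where abs: "i = ((a, b), s)" by (metis surj_pair)
      have "int p dvd (int a + int b) - int s" using i abs by simp
      then have "(int a + int b) mod int p = int s mod int p" by (simp add: mod_eq_dvd_iff)
      then have "int ((a + b) mod p) = int (s mod p)" by (simp add: zmod_int)
      then have "s = (a + b) mod p" using i abs Sp by auto
      then show "i \<in> ?R" using i abs by auto
    qed
    have "int p dvd int a + int b - int ((a + b) mod p)" for a b
      by (simp add: zmod_int dvd_minus_mod)
    then show "?R \<subseteq> ?L" by (auto simp: sumset_mod_def)
  qed
  also have "card ?R = (card A)\<^sup>2"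
    by (subst card_image) (auto simp: inj_on_def card_cartesian_product power2_eq_square)
  finally show ?thesis .
qed

text \<open>Frequency 0 takes n^2 \<sigma> of the total p n^2 in \<open>fourier_sumset\<close>. In
  the rest, one of the two factors \<open>fourier p A d\<close> is bounded by \<open>K\<close>, and
  Cauchy-Schwarz with \<open>parseval\<close> handles the others.\<close>

lemma large_fourier_coefficient:
  fixes K :: real
  assumes "0 < p" "A \<subseteq> {0..<p}" "0 \<le> K" "\<And>d. 0 < d \<Longrightarrow> d < p \<Longrightarrow> norm (fourier p A d) \<le> K"
  defines "n \<equiv> real (card A)" and "\<sigma> \<equiv> real (card (sumset_mod p A))"
  shows "(n\<^sup>2 * (real p - \<sigma>))\<^sup>2 \<le> K\<^sup>2 * ((real p * n - n\<^sup>2) * (real p * \<sigma> - \<sigma>\<^sup>2))"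
proof -
  let ?S = "sumset_mod p A" and ?D = "{..<p} - {0}"
  let ?f = "\<lambda>d. norm (fourier p A d)" and ?g = "\<lambda>d. norm (fourier p (sumset_mod p A) d)"
  have Sp: "?S \<subseteq> {0..<p}" using assms by (auto simp: sumset_mod_def)
  have split: "(\<Sum>d<p. h d) = h 0 + (\<Sum>d\<in>?D. h d)" for h :: "nat \<Rightarrow> 'b::comm_monoid_add"
    using assms(1) by (intro sum.remove) auto
  have f2: "(\<Sum>d\<in>?D. (?f d)\<^sup>2) = real p * n - n\<^sup>2"
    using parseval[OF assms(1,2)] split[of "\<lambda>d. (?f d)\<^sup>2"] by (simp add: n_def)
  have g2: "(\<Sum>d\<in>?D. (?g d)\<^sup>2) = real p * \<sigma> - \<sigma>\<^sup>2"
    using parseval[OF assms(1) Sp] split[of "\<lambda>d. (?g d)\<^sup>2"] by (simp add: \<sigma>_def)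
  have "complex_of_real (n\<^sup>2 * (real p - \<sigma>)) = (\<Sum>d\<in>?D. (fourier p A d)\<^sup>2 * cnj (fourier p ?S d))"
    using fourier_sumset[OF assms(1,2)] split[of "\<lambda>d. (fourier p A d)\<^sup>2 * cnj (fourier p ?S d)"]
    by (simp add: n_def \<sigma>_def algebra_simps)
  then have "n\<^sup>2 * (real p - \<sigma>) \<le> norm (\<Sum>d\<in>?D. (fourier p A d)\<^sup>2 * cnj (fourier p ?S d))"
    by (metis abs_ge_self norm_of_real)
  also have "\<dots> \<le> (\<Sum>d\<in>?D. K * (?f d * ?g d))"
  proof (rule sum_norm_le)
    fix d assume "d \<in> ?D"
    then have "?f d \<le> K" using assms(4) by auto
    then have "?f d * (?f d * ?g d) \<le> K * (?f d * ?g d)" by (intro mult_right_mono) auto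
    then show "norm ((fourier p A d)\<^sup>2 * cnj (fourier p ?S d)) \<le> K * (?f d * ?g d)"
      by (simp add: norm_mult norm_power power2_eq_square mult.assoc)
  qed
  also have "\<dots> = K * (\<Sum>d\<in>?D. ?f d * ?g d)" by (simp add: sum_distrib_left)
  finally have le: "n\<^sup>2 * (real p - \<sigma>) \<le> K * (\<Sum>d\<in>?D. ?f d * ?g d)" .
  have "\<sigma> \<le> real p" using card_mono[OF _ Sp] by (simp add: \<sigma>_def)
  then have "(n\<^sup>2 * (real p - \<sigma>))\<^sup>2 \<le> (K * (\<Sum>d\<in>?D. ?f d * ?g d))\<^sup>2"
    using le by (intro power_mono) auto
  also have "\<dots> = K\<^sup>2 * (\<Sum>d\<in>?D. ?f d * ?g d)\<^sup>2" by (rule power_mult_distrib)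
  also have "\<dots> \<le> K\<^sup>2 * ((\<Sum>d\<in>?D. (?f d)\<^sup>2) * (\<Sum>d\<in>?D. (?g d)\<^sup>2))"
    by (intro mult_left_mono Cauchy_Schwarz_ineq_sum) auto
  finally show ?thesis by (simp only: f2 g2)
qed

section \<open>Concentration on half of the circle\<close>

text \<open>|cos| has period pi, so moving the \<open>p\<close> equidistant samples by one step
  permutes them modulo the period.\<close>

lemma sum_abs_cos_shift:
  assumes "0 < p"
  shows "(\<Sum>i<p. \<bar>cos (pi * real i / real p + (t + pi / real p))\<bar>) = (\<Sum>i<p. \<bar>cos (pi * real i / real p + t)\<bar>)"
proof -
  let ?h = "\<lambda>i. \<bar>cos (pi * real i / real p + t)\<bar>"
  have "(\<Sum>i<p. \<bar>cos (pi * real i / real p + (t + pi / real p))\<bar>) = (\<Sum>i<p. ?h (Suc i))"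
    by (intro sum.cong refl) (simp add: distrib_left add_divide_distrib add_ac)
  also have "\<dots> = (\<Sum>i<Suc p. ?h i) - ?h 0" by (subst sum.lessThan_Suc_shift) simp
  also have "\<dots> = (\<Sum>i<p. ?h i)" using assms by (simp add: cos_add)
  finally show ?thesis .
qed

lemma sum_abs_cos_shift_multiple:
  assumes "0 < p"
  shows "(\<Sum>i<p. \<bar>cos (pi * real i / real p + (t + real k * (pi / real p)))\<bar>) = (\<Sum>i<p. \<bar>cos (pi * real i / real p + t)\<bar>)"
proof (induction k)
  case (Suc k)
  have "t + real (Suc k) * (pi / real p) = (t + real k * (pi / real p)) + pi / real p"
    by (simp add: distrib_right add_divide_distrib)
  then show ?case
    using sum_abs_cos_shift[OF assms, of "t + real k * (pi / real p)"] Suc by (simp only:)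
qed simp

lemma sum_abs_cos_le:
  assumes "0 < p"
  shows "(\<Sum>i<p. \<bar>cos (pi * real i / real p + t)\<bar>) \<le> norm (\<Sum>i<p. cis (pi * real i / real p))"
proof -
  let ?H = "\<lambda>t. \<Sum>i<p. \<bar>cos (pi * real i / real p + t)\<bar>"
  define \<delta> where "\<delta> = pi / real p"
  have \<delta>: "0 < \<delta>" using assms by (simp add: \<delta>_def)
  define k where "k = \<lfloor>(t + pi / 2) / \<delta>\<rfloor>"
  define s where "s = t - of_int k * \<delta>"
  have "of_int k \<le> (t + pi / 2) / \<delta>" "(t + pi / 2) / \<delta> < of_int k + 1"
    by (simp_all add: k_def)
  then have s: "- (pi / 2) \<le> s" "s < - (pi / 2) + \<delta>"
    using \<delta> by (simp_all add: s_def field_simps)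
  have "?H t = ?H s"
  proof (cases "0 \<le> k")
    case True
    then have "t = s + real (nat k) * (pi / real p)" by (simp add: s_def \<delta>_def)
    then show ?thesis using sum_abs_cos_shift_multiple[OF assms, of s "nat k"] by simp
  next
    case False
    then have "s = t + real (nat (- k)) * (pi / real p)" by (simp add: s_def \<delta>_def)
    then show ?thesis using sum_abs_cos_shift_multiple[OF assms, of t "nat (- k)"] by simp
  qed
  also have "?H s = (\<Sum>i<p. cos (pi * real i / real p + s))"
  proof (intro sum.cong refl abs_of_nonneg cos_ge_zero)
    fix i assume i: "i \<in> {..<p}"
    have "0 \<le> pi * real i / real p" by simp
    then show "- (pi / 2) \<le> pi * real i / real p + s" using s by linarith
    have "real i \<le> real p - 1" using i by auto
    then have "pi * real i / real p \<le> pi * (real p - 1) / real p"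
      by (intro divide_right_mono mult_left_mono) auto
    also have "\<dots> = pi - \<delta>" using assms by (simp add: \<delta>_def field_simps)
    finally show "pi * real i / real p + s \<le> pi / 2" using s by linarith
  qed
  also have "\<dots> = Re (cis s * (\<Sum>i<p. cis (pi * real i / real p)))"
    by (simp add: sum_distrib_left cis_mult add.commute)
  also have "\<dots> \<le> norm (cis s * (\<Sum>i<p. cis (pi * real i / real p)))" by (rule complex_Re_le_cmod)
  finally show ?thesis by (simp add: norm_mult)
qed

text \<open>For odd \<open>p\<close> doubling permutes the residues; a wrap-around changes the angle
  by pi, which |cos| ignores.\<close>

lemma sum_abs_cos_double:
  assumes "p = 2 * q + 1"
  shows "(\<Sum>j<p. \<bar>cos (2 * pi * real j / real p + t)\<bar>) = (\<Sum>i<p. \<bar>cos (pi * real i / real p + t)\<bar>)"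
proof (rule sum.reindex_bij_witness[of _ "\<lambda>i. if even i then i div 2 else (i + p) div 2" "\<lambda>j. 2 * j mod p"])
  fix j assume j: "j \<in> {..<p}"
  show "2 * j mod p \<in> {..<p}" using assms by simp
  have *: "2 * j mod p = (if 2 * j < p then 2 * j else 2 * j - p)"
    using j by (auto simp: mod_if)
  then show "(if even (2 * j mod p) then 2 * j mod p div 2 else (2 * j mod p + p) div 2) = j"
    using j assms by auto
  show "\<bar>cos (pi * real (2 * j mod p) / real p + t)\<bar> = \<bar>cos (2 * pi * real j / real p + t)\<bar>"
  proof (cases "2 * j < p")
    case False
    have "pi * real (2 * j - p) / real p + t = (2 * pi * real j / real p + t) - pi"
      using False assms by (simp add: of_nat_diff field_simps)
    then have "cos (pi * real (2 * j - p) / real p + t) = - cos (2 * pi * real j / real p + t)"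
      by (simp only: cos_diff cos_pi sin_pi)
    then show ?thesis using * False by simp
  qed (use * in \<open>simp add: algebra_simps\<close>)
next
  fix i assume i: "i \<in> {..<p}"
  show "(if even i then i div 2 else (i + p) div 2) \<in> {..<p}" using i by auto
  show "2 * (if even i then i div 2 else (i + p) div 2) mod p = i"
  proof (cases "even i")
    case False
    then have "2 * ((i + p) div 2) = i + p" using assms by simp
    then show ?thesis using False i by simp
  qed (use i in auto)
qed

text \<open>Both sums are geometric. With \<tau> = cis (pi / p) and its conjugate \<sigma>, \<tau>^p
  = \<sigma>^p = -1 and 2(q + 1) = p + 1 give the values 2 / (1 - \<tau>) and G = 1 / (1 -
  \<sigma>).\<close>

lemma norm_half_geometric:
  assumes p: "p = 2 * q + 1" and "1 < p"
  defines "G \<equiv> \<Sum>k\<le>q. unity_root p (- int k)"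
  shows "norm (\<Sum>i<p. cis (pi * real i / real p)) = 2 * norm G" "0 < norm G"
proof -
  define \<tau> where "\<tau> = cis (pi / real p)"
  define \<sigma> where "\<sigma> = cis (- (pi / real p))"
  have p0: "0 < real p" using assms by simp
  have \<tau>i: "\<tau> ^ i = cis (pi * real i / real p)" for i
    unfolding \<tau>_def Complex.DeMoivre by (rule arg_cong[of _ _ cis]) simp
  have \<sigma>i: "\<sigma> ^ i = cis (- (pi * real i / real p))" for i
    unfolding \<sigma>_def Complex.DeMoivre by (rule arg_cong[of _ _ cis]) simp
  have \<tau>p: "\<tau> ^ p = -1" unfolding \<tau>i using p0 by simp
  have \<sigma>p: "\<sigma> ^ p = -1" unfolding \<sigma>i using p0 by (simp add: complex_eq_iff)
  have T: "(\<Sum>i<p. cis (pi * real i / real p)) = (\<Sum>i<p. \<tau> ^ i)"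
    unfolding \<tau>i ..
  have "(1 - \<tau>) * (\<Sum>i<p. \<tau> ^ i) = 2" using \<tau>p by (simp add: one_diff_power_eq[symmetric])
  then have nT: "norm (1 - \<tau>) * norm (\<Sum>i<p. \<tau> ^ i) = 2" by (metis norm_mult norm_numeral)
  have "unity_root p (- int k) = (\<sigma> ^ 2) ^ k" for k
  proof -
    have "unity_root p (- int k) = \<sigma> ^ (2 * k)"
      unfolding \<sigma>i unity_root_def by (rule arg_cong[of _ _ cis]) simp
    then show ?thesis by (simp only: power_mult)
  qed
  then have "G = (\<Sum>k<Suc q. (\<sigma> ^ 2) ^ k)" by (simp add: G_def lessThan_Suc_atMost)
  then have "(1 - \<sigma> ^ 2) * G = 1 - (\<sigma> ^ 2) ^ Suc q" by (simp only: one_diff_power_eq)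
  also have "(\<sigma> ^ 2) ^ Suc q = \<sigma> ^ p * \<sigma>"
  proof -
    have "2 * Suc q = Suc p" using p by simp
    then show ?thesis by (metis power_mult power_Suc2)
  qed
  finally have "(1 + \<sigma>) * ((1 - \<sigma>) * G) = (1 + \<sigma>) * 1"
    using \<sigma>p by (simp add: algebra_simps power2_eq_square)
  moreover have "1 + \<sigma> \<noteq> 0"
  proof
    assume "1 + \<sigma> = 0"
    then have "\<sigma> = -1" by (simp add: add_eq_0_iff)
    then have "\<sigma> ^ 2 = 1" by simp
    moreover have "\<sigma> ^ 2 = unity_root p (-1)" 
      unfolding \<sigma>i unity_root_def by (rule arg_cong[of _ _ cis]) simp
    ultimately have "int p dvd -1" using assms by (simp add: unity_root_eq_1_iff)
    then show False using assms by simp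
  qed
  ultimately have "(1 - \<sigma>) * G = 1" by (metis mult_left_cancel)
  then have nG: "norm (1 - \<sigma>) * norm G = 1" by (metis norm_mult norm_one)
  have "1 - \<sigma> = cnj (1 - \<tau>)" by (simp add: \<sigma>_def \<tau>_def cis_cnj)
  then have eq: "norm (1 - \<sigma>) = norm (1 - \<tau>)" by (metis complex_mod_cnj)
  have "norm (1 - \<tau>) \<noteq> 0" using nT by auto
  then show "norm (\<Sum>i<p. cis (pi * real i / real p)) = 2 * norm G"
    using nT nG unfolding T eq by (metis mult.left_commute mult.right_neutral mult_left_cancel)
  show "0 < norm G" using nG by auto
qed

text \<open>\<open>N\<close> is the convolution of \<open>Y\<close> with a half-circle, and its
  coefficient at frequency 1 is \<open>F * G\<close>. Centering at n / 2 and rotating the sum onto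
  the real axis leave weights |cos| of total at most 2 |G|; so \<open>G\<close> cancels and the best
  half-circle inherits all of \<open>norm F\<close>.\<close>

lemma half_circle_concentration:
  assumes p: "p = 2 * q + 1" "1 < p" and Y: "Y \<subseteq> {0..<int p}"
  shows "\<exists>j. real (card Y) + norm (\<Sum>y\<in>Y. unity_root p y) \<le> 2 * real (card {y \<in> Y. (y - j) mod int p \<le> int q})"
proof -
  define N where "N j = card {y \<in> Y. (y - j) mod int p \<le> int q}" for j
  define n where "n = card Y"
  define F where "F = (\<Sum>y\<in>Y. unity_root p y)"
  define G where "G = (\<Sum>k\<le>q. unity_root p (- int k))"
  have fin: "finite Y" using Y finite_subset by blast
  have p0: "0 < p" using p by simp
  have Nn: "N j \<le> n" for j unfolding N_def n_def using fin by (intro card_mono) auto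
  have "\<exists>j0. \<forall>j. N j \<le> N j0"
  proof -
    have fr: "finite (range N)" using Nn by (intro finite_subset[of "range N" "{..n}"]) auto
    then have "Max (range N) \<in> range N" by (intro Max_in) auto
    then show ?thesis using fr by (metis Max_ge rangeE rangeI)
  qed
  then obtain j0 where j0: "N j \<le> N j0" for j by blast
  define D where "D = 2 * real (N j0) - real n"
  \<comment> \<open>Each half-circle has \<open>q + 1\<close> residues, so these two cover the
    circle with one overlap; upper bounds for \<open>N\<close> thus give lower bounds.\<close>
  have comp: "n \<le> N j + N (j + int q + 1)" for j
  proof -
    have "Y \<subseteq> {y \<in> Y. (y - j) mod int p \<le> int q} \<union> {y \<in> Y. (y - (j + int q + 1)) mod int p \<le> int q}"
    proof
      fix y assume y: "y \<in> Y"
      define r where "r = (y - j) mod int p"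
      have r: "0 \<le> r" "r < int p" using p0 by (simp_all add: r_def)
      have "(y - (j + int q + 1)) mod int p = (r - (int q + 1)) mod int p"
        by (simp add: r_def mod_simps algebra_simps)
      moreover have "(r - (int q + 1)) mod int p = r - (int q + 1)" if "int q < r" using that r by simp
      ultimately have far: "(y - (j + int q + 1)) mod int p \<le> int q" if "int q < r"
        using that r p(1) by simp
      show "y \<in> {y \<in> Y. (y - j) mod int p \<le> int q} \<union> {y \<in> Y. (y - (j + int q + 1)) mod int p \<le> int q}"
      proof (cases "r \<le> int q")
        case False
        then show ?thesis using y far by simp
      qed (use y in \<open>simp add: r_def\<close>)
    qed
    then have "n \<le> card ({y \<in> Y. (y - j) mod int p \<le> int q} \<union> {y \<in> Y. (y - (j + int q + 1)) mod int p \<le> int q})"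
      unfolding n_def using fin by (intro card_mono) auto
    also have "\<dots> \<le> N j + N (j + int q + 1)" unfolding N_def by (rule card_Un_le)
    finally show ?thesis .
  qed
  have Dj: "\<bar>2 * real (N j) - real n\<bar> \<le> D" for j
    using j0[of j] j0[of "j + int q + 1"] comp[of j] unfolding D_def by linarith
  have conv: "(\<Sum>j<p. unity_root p (int j) * of_nat (N (int j))) = F * G"
  proof -
    have "(\<Sum>j<p. unity_root p (int j) * of_nat (N (int j))) =
        (\<Sum>j<p. \<Sum>y\<in>Y. if (y - int j) mod int p \<le> int q then unity_root p (int j) else 0)"
    proof (rule sum.cong[OF refl])
      fix j
      have "(\<Sum>y\<in>Y. if (y - int j) mod int p \<le> int q then unity_root p (int j) else 0) =
          (\<Sum>y\<in>{y \<in> Y. (y - int j) mod int p \<le> int q}. unity_root p (int j))"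
        using fin by (intro sum.inter_filter[symmetric])
      then show "unity_root p (int j) * of_nat (N (int j)) =
          (\<Sum>y\<in>Y. if (y - int j) mod int p \<le> int q then unity_root p (int j) else 0)"
        by (simp add: N_def)
    qed
    also have "\<dots> = (\<Sum>y\<in>Y. \<Sum>j<p. if (y - int j) mod int p \<le> int q then unity_root p (int j) else 0)"
      by (rule sum.swap)
    also have "\<dots> = (\<Sum>y\<in>Y. unity_root p y * G)"
    proof (rule sum.cong[OF refl])
      fix y
      have "(\<Sum>j<p. if (y - int j) mod int p \<le> int q then unity_root p (int j) else 0) =
          (\<Sum>k<p. if k \<le> q then unity_root p (y - int k) else 0)"
      proof (rule sum.reindex_bij_witness[of _ "\<lambda>k. nat ((y - int k) mod int p)" "\<lambda>j. nat ((y - int j) mod int p)"])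
        fix j assume j: "j \<in> {..<p}"
        show "nat ((y - int (nat ((y - int j) mod int p))) mod int p) = j"
          using j p0 by (simp add: mod_simps)
        show "nat ((y - int j) mod int p) \<in> {..<p}" using p0 by (simp add: nat_less_iff)
        have "unity_root p (y - (y - int j) mod int p) = unity_root p (int j)"
          using p0 by (intro unity_root_cong) (simp_all add: mod_simps)
        then show "(if nat ((y - int j) mod int p) \<le> q then unity_root p (y - int (nat ((y - int j) mod int p))) else 0) =
            (if (y - int j) mod int p \<le> int q then unity_root p (int j) else 0)"
          using p0 by (simp add: nat_le_iff)
      next
        fix k assume k: "k \<in> {..<p}"
        show "nat ((y - int (nat ((y - int k) mod int p))) mod int p) = k"
          using k p0 by (simp add: mod_simps)
        show "nat ((y - int k) mod int p) \<in> {..<p}" using p0 by (simp add: nat_less_iff)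
      qed
      also have "\<dots> = (\<Sum>k\<in>{k \<in> {..<p}. k \<le> q}. unity_root p (y - int k))"
        by (intro sum.inter_filter[symmetric]) simp
      also have "{k \<in> {..<p}. k \<le> q} = {..q}" using p by auto
      also have "(\<Sum>k\<le>q. unity_root p (y - int k)) = unity_root p y * G"
        by (simp add: G_def sum_distrib_left unity_root_add[symmetric])
      finally show "(\<Sum>j<p. if (y - int j) mod int p \<le> int q then unity_root p (int j) else 0) =
          unity_root p y * G" .
    qed
    also have "\<dots> = F * G" by (simp add: F_def sum_distrib_right)
    finally show ?thesis .
  qed
  have zero: "(\<Sum>j<p. unity_root p (int j)) = 0"
    using sum_unity_root[OF p0, of 1] p by simp
  define Z where "Z = (\<Sum>j<p. unity_root p (int j) * of_real (2 * real (N (int j)) - real n))"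
  have Z: "Z = 2 * (F * G)"
  proof -
    have "Z = 2 * (\<Sum>j<p. unity_root p (int j) * of_nat (N (int j))) - of_nat n * (\<Sum>j<p. unity_root p (int j))"
      by (simp add: Z_def sum_distrib_left sum_subtractf[symmetric] algebra_simps)
    then show ?thesis by (simp add: conv zero)
  qed
  define t where "t = - Arg Z"
  have "norm Z = Re (cis t * Z)"
  proof -
    have "cis t * Z = cis t * (of_real (norm Z) * cis (Arg Z))"
      using rcis_cmod_Arg[of Z] by (simp only: rcis_def)
    also have "\<dots> = of_real (norm Z)"
      by (simp only: mult.left_commute[of "cis (- Arg Z)"] cis_mult t_def add.left_inverse cis_zero mult_1_right)
    finally show ?thesis by simp
  qed
  also have "\<dots> = (\<Sum>j<p. cos (2 * pi * real j / real p + t) * (2 * real (N (int j)) - real n))"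
    by (simp add: Z_def sum_distrib_left unity_root_def mult.assoc[symmetric] cis_mult add.commute)
  also have "\<dots> \<le> (\<Sum>j<p. \<bar>cos (2 * pi * real j / real p + t)\<bar> * D)"
  proof (rule sum_mono)
    fix j
    have "cos (2 * pi * real j / real p + t) * (2 * real (N (int j)) - real n) \<le>
        \<bar>cos (2 * pi * real j / real p + t)\<bar> * \<bar>2 * real (N (int j)) - real n\<bar>"
      by (metis abs_ge_self abs_mult)
    also have "\<dots> \<le> \<bar>cos (2 * pi * real j / real p + t)\<bar> * D" using Dj by (intro mult_left_mono) auto
    finally show "cos (2 * pi * real j / real p + t) * (2 * real (N (int j)) - real n) \<le>
        \<bar>cos (2 * pi * real j / real p + t)\<bar> * D" .
  qed
  also have "\<dots> = (\<Sum>i<p. \<bar>cos (pi * real i / real p + t)\<bar>) * D"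
    by (simp add: sum_distrib_right[symmetric] sum_abs_cos_double[OF p(1)])
  also have "\<dots> \<le> (2 * norm G) * D"
    using sum_abs_cos_le[OF p0, of t] norm_half_geometric(1)[OF p] Dj[of 0]
    by (intro mult_right_mono) (auto simp: G_def)
  finally have "2 * (norm F * norm G) \<le> (2 * norm G) * D" by (simp add: Z norm_mult)
  then have "norm F \<le> D" using norm_half_geometric(2)[OF p] by (simp add: G_def[symmetric])
  then show ?thesis unfolding D_def N_def n_def F_def by (intro exI[of _ j0]) simp
qed

section \<open>The theorem\<close>

lemma card_le_card_sumset_mod:
  assumes "0 < p" "A \<subseteq> {0..<p}"
  shows "card A \<le> card (sumset_mod p A)"
proof (cases "A = {}")
  case False
  then obtain a where a: "a \<in> A" by blast
  have "inj_on (\<lambda>x. (1 * int x + int a) mod int p) A"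
    by (rule inj_on_subset[OF inj_on_affine_mod assms(2)]) simp
  then have "inj_on (\<lambda>x. int ((x + a) mod p)) A" by (simp add: zmod_int)
  then have "inj_on (\<lambda>x. (x + a) mod p) A" by (auto simp: inj_on_def)
  moreover have "(\<lambda>x. (x + a) mod p) ` A \<subseteq> sumset_mod p A" using a by (auto simp: sumset_mod_def)
  moreover have "finite (sumset_mod p A)"
    using sumset_mod_subset[OF assms(1)] finite_subset by blast
  ultimately show ?thesis by (rule card_inj_on_le)
qed simp

text \<open>Dilation by \<open>d\<close> moves frequency \<open>d\<close> to 1, and a shift brings
  the half-circle found there to \<open>{0..q}\<close>.\<close>

lemma large_half_circle:
  assumes p: "p = 2 * q + 1" "1 < p" and A: "A \<subseteq> {0..<p}" and u: "coprime (int d) (int p)"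
  shows "\<exists>w A'. A' \<subseteq> A \<and> (\<lambda>x. (int d * int x + w) mod int p) ` A' \<subseteq> {0..int q} \<and>
    real (card A) + norm (fourier p A d) \<le> 2 * real (card A')"
proof -
  have p0: "0 < p" using p by simp
  define f where "f x = (int d * int x + 0) mod int p" for x
  define Y where "Y = f ` A"
  have inj: "inj_on f A" unfolding f_def using inj_on_affine_mod[OF u] A by (rule inj_on_subset)
  have "(\<Sum>y\<in>Y. unity_root p y) = (\<Sum>x\<in>A. unity_root p (f x))"
    unfolding Y_def by (simp add: sum.reindex[OF inj])
  also have "\<dots> = fourier p A d"
    unfolding fourier_def f_def using p0 by (intro sum.cong refl unity_root_cong) (simp_all add: mult.commute)
  finally have sumY: "(\<Sum>y\<in>Y. unity_root p y) = fourier p A d" .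
  have cY: "card Y = card A" unfolding Y_def by (rule card_image[OF inj])
  have "Y \<subseteq> {0..<int p}" using p0 by (auto simp: Y_def f_def)
  then obtain j where j: "real (card Y) + norm (\<Sum>y\<in>Y. unity_root p y) \<le>
      2 * real (card {y \<in> Y. (y - j) mod int p \<le> int q})"
    using half_circle_concentration[OF p] by blast
  define A' where "A' = {x \<in> A. (f x - j) mod int p \<le> int q}"
  have "A' \<subseteq> A" by (auto simp: A'_def)
  have "{y \<in> Y. (y - j) mod int p \<le> int q} = f ` A'" by (auto simp: Y_def A'_def)
  then have "card {y \<in> Y. (y - j) mod int p \<le> int q} = card A'"
    using inj_on_subset[OF inj \<open>A' \<subseteq> A\<close>] by (simp add: card_image)
  moreover have "(int d * int x + (- j)) mod int p = (f x - j) mod int p" for x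
    by (simp add: f_def mod_simps)
  then have "(\<lambda>x. (int d * int x + (- j)) mod int p) ` A' \<subseteq> {0..int q}"
    using p0 by (auto simp: A'_def)
  ultimately show ?thesis
    using j \<open>A' \<subseteq> A\<close> unfolding cY sumY by (intro exI[of _ "- j"] exI[of _ A']) auto
qed

text \<open>The cubic is (1 + 2\<alpha>)^2 (2 + \<alpha> - \<epsilon>) - 9 (1 - \<epsilon>).\<close>

lemma coefficient_threshold:
  fixes n \<sigma> P \<epsilon> \<alpha> :: real
  assumes cubic: "4 * \<alpha>^3 + (12 - 4*\<epsilon>) * \<alpha>^2 + (9 - 4*\<epsilon>) * \<alpha> + (8*\<epsilon> - 7) = 0"
    and "0 < \<alpha>" "\<epsilon> < 1" and n: "0 < n" "n \<le> \<sigma>" and \<sigma>: "\<sigma> < (2 + \<alpha>) * n" "\<sigma> \<le> \<epsilon> * P" "\<sigma> < P"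
  shows "((1 + 2 * \<alpha>) * n / 3)\<^sup>2 * ((P * n - n\<^sup>2) * (P * \<sigma> - \<sigma>\<^sup>2)) < (n\<^sup>2 * (P - \<sigma>))\<^sup>2"
proof -
  define c where "c = (1 + 2 * \<alpha>)\<^sup>2"
  define b where "b = 2 + \<alpha> - \<epsilon>"
  have b: "0 < b" using assms by (simp add: b_def)
  have cb: "c * b = 9 * (1 - \<epsilon>)"
    using cubic by (simp add: c_def b_def algebra_simps power2_eq_square power3_eq_cube)
  have "(\<sigma> - n) * (\<epsilon> * P - \<sigma>) \<ge> 0" using n \<sigma> by (intro mult_nonneg_nonneg) auto
  then have "(1 - \<epsilon>) * ((P - n) * \<sigma>) \<le> (P - \<sigma>) * (\<sigma> - \<epsilon> * n)" by (simp add: algebra_simps)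
  also have "\<dots> < (P - \<sigma>) * (n * b)"
    using \<sigma> by (intro mult_strict_left_mono) (simp_all add: b_def algebra_simps)
  finally have "9 * ((1 - \<epsilon>) * ((P - n) * \<sigma>)) < 9 * ((P - \<sigma>) * (n * b))" by simp
  then have "c * b * ((P - n) * \<sigma>) < 9 * ((P - \<sigma>) * (n * b))" by (simp only: cb mult.assoc)
  then have "b * (c * ((P - n) * \<sigma>)) < b * (9 * ((P - \<sigma>) * n))" by (simp add: mult_ac)
  then have *: "c * ((P - n) * \<sigma>) < 9 * ((P - \<sigma>) * n)" using b by simp
  have "((1 + 2 * \<alpha>) * n / 3)\<^sup>2 * ((P * n - n\<^sup>2) * (P * \<sigma> - \<sigma>\<^sup>2)) =
      (n ^ 3 * (P - \<sigma>) / 9) * (c * ((P - n) * \<sigma>))"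
    by (simp add: c_def power_divide power_mult_distrib power2_eq_square power3_eq_cube field_simps)
  also have "\<dots> < (n ^ 3 * (P - \<sigma>) / 9) * (9 * ((P - \<sigma>) * n))"
    using * n \<sigma> by (intro mult_strict_left_mono) auto
  also have "\<dots> = (n\<^sup>2 * (P - \<sigma>))\<^sup>2"
    by (simp add: power2_eq_square power3_eq_cube field_simps)
  finally show ?thesis .
qed

theorem theorem2p1:
  fixes p :: nat and \<epsilon> \<alpha> :: real and A :: "nat set"
  assumes "prime p"
    and "0 < \<epsilon>" and "\<epsilon> \<le> 3/4"
    and "\<alpha> > 0"
    and "4 * \<alpha>^3 + (12 - 4*\<epsilon>) * \<alpha>^2 + (9 - 4*\<epsilon>) * \<alpha> + (8*\<epsilon> - 7) = 0"
    and "A \<subseteq> {0..<p}" and "A \<noteq> {}"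
    and "real (card (sumset_mod p A)) \<le> (2 + \<alpha>) * real (card A) - 3"
    and "real (card (sumset_mod p A)) \<le> \<epsilon> * real p"
  shows "\<exists>g PA P2A. is_ap_diff p g PA \<and> is_ap_diff p g P2A \<and>
           A \<subseteq> PA \<and>
           int (card PA) \<le> int (card A) + (int (card (sumset_mod p A)) - 2 * int (card A)) + 1 \<and>
           P2A \<subseteq> sumset_mod p A \<and>
           int (card P2A) \<ge> 2 * int (card A) - 1"
proof -
  define n where "n = real (card A)"
  define \<sigma> where "\<sigma> = real (card (sumset_mod p A))"
  have p1: "1 < p" using assms(1) by (rule prime_gt_1_nat)
  have finA: "finite A" using assms(6) finite_subset by blast
  \<comment> \<open>At 1/2 the cubic equals 1 + 5 \<epsilon> > 0, and it increases on the positive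
    axis.\<close>
  have \<alpha>: "\<alpha> < 1 / 2"
  proof (rule ccontr)
    assume "\<not> \<alpha> < 1 / 2"
    then have a: "1 / 2 \<le> \<alpha>" by simp
    then have "(1 / 2) ^ 3 \<le> \<alpha> ^ 3" "(1 / 2) ^ 2 \<le> \<alpha> ^ 2" by (intro power_mono; simp)+
    moreover have "(12 - 4 * \<epsilon>) * (1 / 2) ^ 2 \<le> (12 - 4 * \<epsilon>) * \<alpha> ^ 2"
      "(9 - 4 * \<epsilon>) * (1 / 2) \<le> (9 - 4 * \<epsilon>) * \<alpha>"
      using a assms(3) calculation by (intro mult_left_mono; simp)+
    ultimately show False using assms(2,5) by (simp add: power2_eq_square power3_eq_cube)
  qed
  have n1: "1 \<le> n" using finA assms(7) by (simp add: n_def Suc_le_eq card_gt_0_iff)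
  have n\<sigma>: "n \<le> \<sigma>"
    using card_le_card_sumset_mod[OF _ assms(6)] p1 by (simp add: n_def \<sigma>_def)
  \<comment> \<open>With n <= \<sigma> the hypothesis on the sumset gives (1 + \<alpha>) n >= 3,
    which rules out a singleton and thereby p = 2.\<close>
  have "\<alpha> * n \<le> 1 / 2 * n" using \<alpha> n1 by (intro mult_right_mono) auto
  then have n2: "2 \<le> n" using n\<sigma> assms(8) by (simp add: n_def \<sigma>_def algebra_simps)
  have "\<epsilon> * real p \<le> 3 / 4 * real p" using assms(3) by (intro mult_right_mono) auto
  then have \<sigma>p: "4 * \<sigma> \<le> 3 * real p" using assms(9) by (simp add: \<sigma>_def)
  then have "2 < p" using n2 n\<sigma> by linarith
  then have "odd p" using assms(1) prime_odd_nat by blast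
  then obtain q where q: "p = 2 * q + 1" by (rule oddE)

  \<comment> \<open>\<open>K\<close> solves 3 (n + K) / 2 = (2 + \<alpha>) n, whose right side is at
    least \<sigma> + 3; the half-circle will hold more than (n + K) / 2 elements.\<close>
  define K where "K = (1 + 2 * \<alpha>) * n / 3"
  have "\<exists>d. 0 < d \<and> d < p \<and> K < norm (fourier p A d)"
  proof (rule ccontr)
    assume "\<not> ?thesis"
    then have "norm (fourier p A d) \<le> K" if "0 < d" "d < p" for d using that by (meson not_less)
    moreover have "0 \<le> K" using n1 assms(4) by (simp add: K_def)
    ultimately have "(n\<^sup>2 * (real p - \<sigma>))\<^sup>2 \<le> K\<^sup>2 * ((real p * n - n\<^sup>2) * (real p * \<sigma> - \<sigma>\<^sup>2))"
      unfolding n_def \<sigma>_def using p1 assms(6) by (intro large_fourier_coefficient) simp_all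
    moreover have "K\<^sup>2 * ((real p * n - n\<^sup>2) * (real p * \<sigma> - \<sigma>\<^sup>2)) < (n\<^sup>2 * (real p - \<sigma>))\<^sup>2"
      unfolding K_def using assms n1 n\<sigma> \<sigma>p p1
      by (intro coefficient_threshold[of \<alpha> \<epsilon>]) (auto simp: n_def \<sigma>_def)
    ultimately show False by simp
  qed
  then obtain d where d: "0 < d" "d < p" "K < norm (fourier p A d)" by blast
  have cop: "coprime (int d) (int p)"
    using d by (intro coprime_prime_if_between[OF assms(1)]) auto
  obtain w A' where A': "A' \<subseteq> A" "(\<lambda>x. (int d * int x + w) mod int p) ` A' \<subseteq> {0..int q}"
    "n + norm (fourier p A d) \<le> 2 * real (card A')"
    using large_half_circle[OF q p1 assms(6) cop] unfolding n_def by blast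
  have "2 * (\<sigma> + 3) \<le> 3 * n + 3 * K"
    using assms(8) by (simp add: K_def n_def \<sigma>_def field_simps)
  \<comment> \<open>Strictness in the choice of \<open>d\<close> raises the 3 to a 4 over the
    integers, as Freiman's theorem requires.\<close>
  then have "\<sigma> + 3 < 3 * real (card A')" using A'(3) d(3) by (smt (verit))
  then have large: "card (sumset_mod p A) + 4 \<le> 3 * card A'" unfolding \<sigma>_def by linarith
  have h: "int q = (int p - 1) div 2" using q by simp
  have sparse: "4 * card (sumset_mod p A) \<le> 3 * p" using \<sigma>p unfolding \<sigma>_def by linarith
  obtain u w where uw: "coprime u (int p)" "(\<lambda>x. (u * int x + w) mod int p) ` A \<subseteq> {0..int q}"
    using rectify_superset[OF h assms(1,6) A'(1) cop A'(2) large sparse] by blast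
  have "card A' \<le> card A" using finA A'(1) by (rule card_mono)
  then have "card (sumset_mod p A) + 4 \<le> 3 * card A" using large by linarith
  then show ?thesis
    using q by (intro conclusion_if_rectified[OF assms(1,6) uw]) simp_all
qed

end
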